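(* Let $g\ge 1$, let $p_1,\dots,p_g$ be distinct odd primes, $n=p_1\cdots p_g$, $q$ a prime power with $\gcd(n,q)=1$, $N'=\mathrm{ord}_n(q)$, and $\theta$ a primitive $n$-th root of unity in $\mathbb{F}_{q^{N'}}$. Consider the QR codes of length $n$ defined in the context. Then: (1) the number of QR codes of length $n$ is $\prod_{r=0}^{g-1}\bigl(2(2^{g-r}-1)\bigr)^{\binom{g}{r}}$; (2) there exists an LCD QR code of length $n$ if and only if $p_i\equiv 1\pmod 4$ for every $i=1,\dots,g$; (3) there exists a self-orthogonal QR code of length $n$ if and only if $p_i\equiv 3\pmod 4$ for every $i=1,\dots,g$.
   Context: For $0\le r\le g-1$, $A_r$ is the set of all products of $r$ distinct primes among $p_1,\dots,p_g$ ($A_0=\{1\}$). For $d\in A_r$: $M_d=\{j:1\le j\le n-1,\gcd(j,n)=d\}$, $M^*_d=\{Q: Q\mid n/d,\ Q>1\}$, and for $Q\in M^*_d$, $\epsilon\in\{\pm1\}$: $M^\epsilon_{d,Q}=\{j\in M_d:(\tfrac{j}{Q})=\epsilon\}$ (Jacobi symbol), $F^\epsilon_{d,Q}(x)=\prod_{t\in M^\epsilon_{d,Q}}(x-\theta^t)$. A QR code of length $n$ is the cyclic code of length $n$ (an ideal of $K[x]/(x^n-1)$ with $K=\mathbb{F}_{q^{N'}}$, or $K=\mathbb{F}_q$ when the generator has coefficients in $\mathbb{F}_q$) generated by $g(x)=\prod_{r=0}^{g-1}\prod_{d\in A_r}F^{\epsilon_d}_{d,Q_d}(x)$, for a choice of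 $Q_d\in M^*_d$ and $\epsilon_d\in\{1,-1\}$ for each $d\in\bigcup_r A_r$. A linear code $\mathcal{C}$ is LCD if $\mathcal{C}\cap\mathcal{C}^\perp=\{0\}$, and (in this paper's terminology) self-orthogonal if $\mathcal{C}\cap\mathcal{C}^\perp=\mathcal{C}^\perp$, i.e. $\mathcal{C}^\perp\subseteq\mathcal{C}$, where $\perp$ is the dual for the standard inner product. *)

theory Defs
  imports "HOL-Library.Cardinality" "HOL-Number_Theory.Number_Theory"
    "HOL-Computational_Algebra.Computational_Algebra"
begin

definition Jacobi :: "int \<Rightarrow> nat \<Rightarrow> int" where
  "Jacobi a Q = (\<Prod>p\<in>#prime_factorization Q. Legendre a (int p))"

definition prim_root_unity :: "nat \<Rightarrow> 'a::field \<Rightarrow> bool" where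
  "prim_root_unity n \<theta> \<longleftrightarrow> \<theta> ^ n = 1 \<and> (\<forall>k. 0 < k \<and> k < n \<longrightarrow> \<theta> ^ k \<noteq> 1)"

text \<open>The copy of $F_q$ inside a finite extension field of it: the fixed points of
  the $q$-Frobenius.\<close>

definition Fq :: "nat \<Rightarrow> 'a::field set" where
  "Fq q = {x. x ^ q = x}"

definition polys_over :: "'a::field set \<Rightarrow> 'a poly set" where
  "polys_over K = {f. set (Polynomial.coeffs f) \<subseteq> K}"

text \<open>Words of length $n$ over $K$ (a subfield, given as a set) are represented by the
  polynomials over $K$ of degree less than $n$, i.e. by the canonical representatives of
  the classes in $K[x]/(x^n-1)$.\<close>

definition words :: "'a::field set \<Rightarrow> nat \<Rightarrow> 'a poly set" where
  "words K n = {c \<in> polys_over K. Polynomial.degree c < n}"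

definition cyclic_code :: "'a::field set \<Rightarrow> nat \<Rightarrow> 'a poly \<Rightarrow> 'a poly set" where
  "cyclic_code K n f = {(a * f) mod (Polynomial.monom 1 n - 1) | a. a \<in> polys_over K}"

definition dual_code :: "'a::field set \<Rightarrow> nat \<Rightarrow> 'a poly set \<Rightarrow> 'a poly set" where
  "dual_code K n C =
     {v \<in> words K n. \<forall>c\<in>C. (\<Sum>i<n. Polynomial.coeff v i * Polynomial.coeff c i) = 0}"

definition LCD_code :: "'a::field set \<Rightarrow> nat \<Rightarrow> 'a poly set \<Rightarrow> bool" where
  "LCD_code K n C \<longleftrightarrow> C \<inter> dual_code K n C = {0}"

text \<open>Here a code is called self-orthogonal if it contains its dual (elsewhere often called
  dual-containing).\<close>

definition self_orthogonal :: "'a::field set \<Rightarrow> nat \<Rightarrow> 'a poly set \<Rightarrow> bool" where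
  "self_orthogonal K n C \<longleftrightarrow> C \<inter> dual_code K n C = dual_code K n C"

definition A_set :: "(nat \<Rightarrow> nat) \<Rightarrow> nat \<Rightarrow> nat \<Rightarrow> nat set" where
  "A_set p g r = {\<Prod>i\<in>S. p i | S. S \<subseteq> {1..g} \<and> card S = r}"

definition M_set :: "nat \<Rightarrow> nat \<Rightarrow> nat set" where
  "M_set n d = {j. 1 \<le> j \<and> j \<le> n - 1 \<and> gcd j n = d}"

definition M_star :: "nat \<Rightarrow> nat \<Rightarrow> nat set" where
  "M_star n d = {Q. Q dvd n div d \<and> Q > 1}"

definition M_eps :: "nat \<Rightarrow> nat \<Rightarrow> nat \<Rightarrow> int \<Rightarrow> nat set" where
  "M_eps n d Q \<epsilon> = {j \<in> M_set n d. Jacobi (int j) Q = \<epsilon>}"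

definition F_poly :: "'a::field \<Rightarrow> nat \<Rightarrow> nat \<Rightarrow> nat \<Rightarrow> int \<Rightarrow> 'a poly" where
  "F_poly \<theta> n d Q \<epsilon> = (\<Prod>t\<in>M_eps n d Q \<epsilon>. [:- (\<theta> ^ t), 1:])"

definition QR_generator ::
    "'a::field \<Rightarrow> (nat \<Rightarrow> nat) \<Rightarrow> nat \<Rightarrow> nat \<Rightarrow> (nat \<Rightarrow> nat) \<Rightarrow> (nat \<Rightarrow> int) \<Rightarrow> 'a poly" where
  "QR_generator \<theta> p g n Q \<epsilon> = (\<Prod>r<g. \<Prod>d\<in>A_set p g r. F_poly \<theta> n d (Q d) (\<epsilon> d))"

definition QR_choice ::
    "(nat \<Rightarrow> nat) \<Rightarrow> nat \<Rightarrow> nat \<Rightarrow> (nat \<Rightarrow> nat) \<Rightarrow> (nat \<Rightarrow> int) \<Rightarrow> bool" where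
  "QR_choice p g n Q \<epsilon> \<longleftrightarrow>
     (\<forall>d \<in> (\<Union>r<g. A_set p g r). Q d \<in> M_star n d \<and> \<epsilon> d \<in> {1, -1})"

text \<open>A code with generator $f$ is taken over the whole field, or over $F_q$, the latter only
  if $f$ has coefficients in $F_q$. A base field rule says which of the two is used for each
  generator; so it may be constantly the whole field, or $F_q$ whenever possible.\<close>

definition base_field_rule :: "nat \<Rightarrow> ('a::field poly \<Rightarrow> 'a set) \<Rightarrow> bool" where
  "base_field_rule q \<kappa> \<longleftrightarrow> (\<forall>f. \<kappa> f = UNIV \<or> (\<kappa> f = Fq q \<and> f \<in> polys_over (Fq q)))"

text \<open>\<open>C\<close> is a QR code of length $n$ over the field \<open>K\<close>.\<close>

definition QR_code ::
    "('a::field poly \<Rightarrow> 'a set) \<Rightarrow> 'a \<Rightarrow> (nat \<Rightarrow> nat) \<Rightarrow> nat \<Rightarrow> nat \<Rightarrow> 'a set \<Rightarrow> 'a poly set \<Rightarrow> bool"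
  where
  "QR_code \<kappa> \<theta> p g n K C \<longleftrightarrow>
     (\<exists>Q \<epsilon>. QR_choice p g n Q \<epsilon> \<and> K = \<kappa> (QR_generator \<theta> p g n Q \<epsilon>) \<and>
            C = cyclic_code K n (QR_generator \<theta> p g n Q \<epsilon>))"

end

theory Submission
  imports Defs
begin

text \<open>
  Let $T$ be the set of exponents $t$ such that $\theta^t$ is a root of the generator. Fourier
  inversion on the $n$-th roots of unity shows that a word $v$ lies in the dual of the code iff
  $v(\theta^{-j}) = 0$ for all $j \notin T$. Hence the code is LCD iff $T = -T$, and it contains
  its dual iff $T \cap -T = \emptyset$. On the piece of $T$ belonging to $d$, negation multiplies
  the Jacobi symbol by $(\frac{-1}{Q_d})$, so the two conditions say that this sign is $1$ for all
  $d$, respectively $-1$ for all $d$. For $d = n / p_i$ the only choice is $Q_d = p_i$. By the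
  Chinese remainder theorem the Legendre symbols of $j$ at the primes dividing $n$ can be prescribed
  independently, so different choices of $(Q_d, \epsilon_d)$ give different sets $T$, and $T$ is
  recovered from the code as its set of common zeros.
\<close>

subsection \<open>Squarefree numbers and Legendre symbols\<close>

text \<open>A code may live over the whole field or over F_q, and the argument has to serve both.
  Vanishing on the zeros gives divisibility only over the whole field, so the cofactor must be shown
  to have coefficients in the base field, and the words that refute LCD or self-orthogonality must
  lie over it too. Both points rest on the q-power Frobenius: it fixes the coefficients of a
  generator over F_q and hence permutes its zeros, so a word whose values on the roots of unity are
  n times the indicator of a Frobenius-stable set has its coefficients in F_q.

  In the existence proofs, primes that are all 1 modulo 4 give sign 1 for every modulus. If all are
  3 modulo 4, a modulus with an even number of primes would still give sign 1, so a single prime is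
  taken.

  The exponent 0 lies in no piece, as d runs over proper divisors. The zero 1 would be its own
  inverse and would rule out every self-orthogonal code.\<close>

lemma squarefree_prod_prime_factors:
  fixes m :: nat
  assumes "squarefree m"
  shows "\<Prod>(prime_factors m) = m"
proof -
  have "m \<noteq> 0" using assms by (metis not_squarefree_0)
  then have "(\<Prod>p\<in>prime_factors m. p ^ multiplicity p m) = m"
    using prod_prime_factors[of m] by simp
  moreover have "(\<Prod>p\<in>prime_factors m. p ^ multiplicity p m) = (\<Prod>p\<in>prime_factors m. p)"
    using assms squarefree_factorial_semiring'[OF \<open>m \<noteq> 0\<close>] by (intro prod.cong) auto
  ultimately show ?thesis by simp
qed

lemma squarefree_prime_factors_eqI:
  fixes a b :: nat
  assumes "squarefree a" "squarefree b" "prime_factors a = prime_factors b"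
  shows "a = b"
  using assms squarefree_prod_prime_factors by metis

lemma squarefree_prod_primes:
  fixes S :: "nat set"
  assumes "finite S" "\<And>p. p \<in> S \<Longrightarrow> prime p"
  shows "squarefree (\<Prod>S)" "prime_factors (\<Prod>S) = S"
proof -
  show "squarefree (\<Prod>S)"
    using assms by (intro squarefree_prod_coprime) (auto intro: primes_coprime squarefree_prime)
  have "prime_factors (\<Prod>S) = (\<Union>p\<in>S. prime_factors p)"
    using assms by (subst prime_factors_prod) (auto dest: assms(2))
  also have "\<dots> = S"
    using assms by (auto simp: prime_factorization_prime)
  finally show "prime_factors (\<Prod>S) = S" .
qed

text \<open>Each prime occurs once, so the product over the multiset is one over a set, where single
  factors can be isolated.\<close>

lemma Jacobi_squarefree:
  assumes "squarefree Q"
  shows "Jacobi a Q = (\<Prod>p\<in>prime_factors Q. Legendre a (int p))"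
proof -
  have "Q \<noteq> 0" using assms by (metis not_squarefree_0)
  have "count (prime_factorization Q) p \<le> 1" for p
    using assms squarefree_factorial_semiring''[OF \<open>Q \<noteq> 0\<close>]
    by (cases "prime p") (auto simp: count_prime_factorization)
  then have "count (prime_factorization Q) p = count (mset_set (prime_factors Q)) p" for p
    by (cases "p \<in> prime_factors Q") (auto simp: not_in_iff[symmetric] le_Suc_eq)
  then have eq: "prime_factorization Q = mset_set (prime_factors Q)"
    by (rule multiset_eqI)
  show ?thesis unfolding Jacobi_def
    by (subst eq) (rule prod_unfold_prod_mset[symmetric])
qed

lemma Legendre_cong:
  assumes "[a = b] (mod p)"
  shows "Legendre a p = Legendre b p"
proof -
  have "[a = 0] (mod p) \<longleftrightarrow> [b = 0] (mod p)"
    using assms by (meson cong_sym cong_trans)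
  moreover have "QuadRes p a \<longleftrightarrow> QuadRes p b"
    unfolding QuadRes_def using assms by (meson cong_sym cong_trans)
  ultimately show ?thesis unfolding Legendre_def by simp
qed

lemma Legendre_values: "Legendre a p \<in> {0, 1, -1}"
  by (simp add: Legendre_def)

text \<open>Two elements of {0, 1, -1} differ by at most 2, which is less than \<open>p\<close>.
  This turns the congruence of Euler's criterion into an equation.\<close>

lemma Legendre_eqI:
  assumes "p > 2" "x \<in> {0,1,-1}" "[Legendre a (int p) = x] (mod int p)"
  shows "Legendre a (int p) = x"
proof (rule ccontr)
  assume ne: "Legendre a (int p) \<noteq> x"
  have "int p dvd Legendre a (int p) - x"
    using assms by (simp add: cong_iff_dvd_diff)
  with ne have "int p \<le> \<bar>Legendre a (int p) - x\<bar>"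
    using dvd_imp_le_int[of "Legendre a (int p) - x" "int p"] by simp
  then show False using Legendre_values[of a "int p"] assms by auto
qed

lemma Legendre_minus:
  assumes "prime p" "p > 2"
  shows "Legendre (- a) (int p) = Legendre (- 1) (int p) * Legendre a (int p)"
proof (rule Legendre_eqI)
  show "Legendre (- 1) (int p) * Legendre a (int p) \<in> {0, 1, -1}"
    using Legendre_values[of "-1" "int p"] Legendre_values[of a "int p"] by auto
  have "[Legendre (- a) (int p) = (- a) ^ ((p - 1) div 2)] (mod int p)"
    by (rule euler_criterion[OF assms])
  also have "(- a) ^ ((p - 1) div 2) = (- 1) ^ ((p - 1) div 2) * a ^ ((p - 1) div 2)"
    by (rule power_minus)
  also have "[\<dots> = Legendre (- 1) (int p) * Legendre a (int p)] (mod int p)"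
    by (intro cong_mult cong_sym[OF euler_criterion[OF assms]])
  finally show "[Legendre (- a) (int p) = Legendre (- 1) (int p) * Legendre a (int p)] (mod int p)" .
qed fact

lemma Legendre_minus_one:
  assumes "prime p" "p > 2"
  shows "Legendre (- 1) (int p) = (if p mod 4 = 1 then 1 else - 1)"
proof (rule Legendre_eqI)
  have "odd p" using assms prime_odd_nat by blast
  then have "(- 1 :: int) ^ ((p - 1) div 2) = (if p mod 4 = 1 then 1 else - 1)"
  proof (cases "p mod 4 = 1")
    case True
    then have "even ((p - 1) div 2)" by presburger
    then show ?thesis using True by simp
  next
    case False
    then have "odd ((p - 1) div 2)" using \<open>odd p\<close> by presburger
    then show ?thesis using False by simp
  qed
  then show "[Legendre (- 1) (int p) = (if p mod 4 = 1 then 1 else - 1)] (mod int p)"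
    using euler_criterion[OF assms, of "-1"] by simp
qed (use assms in auto)

text \<open>If every residue were a square or 0, squaring would map the finite set of residues onto
  itself and so be injective; but 1 and \<open>p - 1\<close> have the same square.\<close>

lemma ex_quadratic_nonresidue:
  assumes "prime p" "p > 2"
  shows "\<exists>u::nat. Legendre (int u) (int p) = - 1"
proof (rule ccontr)
  assume no: "\<nexists>u::nat. Legendre (int u) (int p) = - 1"
  define sq where "sq = (\<lambda>y::nat. y ^ 2 mod p)"
  have "{..<p} \<subseteq> sq ` {..<p}"
  proof
    fix u assume u: "u \<in> {..<p}"
    have "\<exists>y. [y ^ 2 = int u] (mod int p)"
    proof (cases "[int u = 0] (mod int p)")
      case True
      then show ?thesis by (intro exI[of _ 0]) (auto intro: cong_sym)
    next
      case False
      then have "QuadRes (int p) (int u)"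
        using no unfolding Legendre_def by (metis (full_types))
      then show ?thesis by (simp add: QuadRes_def)
    qed
    then obtain y where y: "[y ^ 2 = int u] (mod int p)" by blast
    define z where "z = nat (y mod int p)"
    have z: "int z = y mod int p" unfolding z_def using assms by simp
    have "[int z ^ 2 = int u] (mod int p)"
      unfolding z using y by (simp add: cong_def power_mod)
    then have "[z ^ 2 = u] (mod p)" by (metis cong_int_iff of_nat_power)
    then have "sq z = u" using u by (simp add: sq_def cong_def)
    moreover have "z < p"
      using z assms by (metis of_nat_0_less_iff of_nat_less_iff pos_mod_bound prime_gt_0_nat)
    ultimately show "u \<in> sq ` {..<p}" by auto
  qed
  then have "inj_on sq {..<p}"
    by (intro eq_card_imp_inj_on) (use card_mono[of "sq ` {..<p}" "{..<p}"] card_image_le[of "{..<p}" sq] in auto)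
  moreover have "sq 1 = sq (p - 1)"
  proof -
    have "[int (p - 1) ^ 2 = 1] (mod int p)"
    proof -
      have "int (p - 1) ^ 2 - 1 = int p * (int p - 2)"
        using assms by (simp add: of_nat_diff power2_eq_square algebra_simps)
      then show ?thesis unfolding cong_iff_dvd_diff by simp
    qed
    then have "[(p - 1) ^ 2 = 1] (mod p)" by (metis cong_int_iff of_nat_1 of_nat_power)
    then show ?thesis by (simp add: sq_def cong_def)
  qed
  ultimately have "1 = p - 1" using assms by (auto dest: inj_onD)
  then show False using assms by simp
qed

lemma ex_Legendre_eq:
  assumes "prime p" "p > 2" "x \<in> {0,1,-1}"
  shows "\<exists>u::nat. Legendre (int u) (int p) = x"
proof -
  have "Legendre (int 0) (int p) = 0" by (simp add: Legendre_def)
  moreover have "Legendre (int 1) (int p) = 1"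
  proof -
    have "QuadRes (int p) 1" unfolding QuadRes_def by (intro exI[of _ 1]) simp
    then show ?thesis using assms by (auto simp: Legendre_def cong_def)
  qed
  ultimately show ?thesis using ex_quadratic_nonresidue[OF assms(1,2)] assms(3) by blast
qed

text \<open>The value 0 is allowed because it encodes divisibility by \<open>p\<close>: prescribing
  symbols then also prescribes the gcd with \<open>n\<close>.\<close>

lemma ex_prescribed_Legendre:
  fixes n :: nat
  assumes "squarefree n" "odd n" "\<And>p. p \<in> prime_factors n \<Longrightarrow> s p \<in> {0,1,-1}"
  shows "\<exists>j<n. \<forall>p\<in>prime_factors n. Legendre (int j) (int p) = s p"
proof -
  have P: "prime p \<and> p > 2" if "p \<in> prime_factors n" for p
  proof -
    have "prime p" "p dvd n" using that by auto
    then have "p \<noteq> 2" using assms(2) by auto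
    then show ?thesis using \<open>prime p\<close> prime_ge_2_nat[of p] by auto
  qed
  then have "\<forall>p\<in>prime_factors n. \<exists>u::nat. Legendre (int u) (int p) = s p"
    using ex_Legendre_eq assms(3) by blast
  then obtain u :: "nat \<Rightarrow> nat" where u: "\<forall>p\<in>prime_factors n. Legendre (int (u p)) (int p) = s p"
    by metis
  have "\<exists>!x. x < (\<Prod>p\<in>prime_factors n. p) \<and> (\<forall>p\<in>prime_factors n. [x = u p] (mod p))"
  proof (rule chinese_remainder_unique_nat)
    show "\<forall>p\<in>prime_factors n. p \<noteq> 0" using P by fastforce
    show "\<forall>p\<in>prime_factors n. \<forall>q\<in>prime_factors n. p \<noteq> q \<longrightarrow> coprime p q"
      using P primes_coprime by blast
  qed simp
  then obtain x where x: "x < \<Prod>(prime_factors n)" "\<forall>p\<in>prime_factors n. [x = u p] (mod p)"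
    by auto
  have "Legendre (int x) (int p) = s p" if "p \<in> prime_factors n" for p
    using x(2) u that Legendre_cong[of "int x" "int (u p)" "int p"] by (metis cong_int_iff)
  then show ?thesis using x(1) squarefree_prod_prime_factors[OF assms(1)] by auto
qed

subsection \<open>The Jacobi classes of the residues with given gcd\<close>

lemma proper_divisor_cofactor:
  fixes n d :: nat
  assumes "squarefree n" "d dvd n" "d \<noteq> n"
  shows "squarefree d" "squarefree (n div d)" "n div d > 1"
    "prime_factors (n div d) = prime_factors n - prime_factors d"
proof -
  have n0: "n \<noteq> 0" using assms(1) by (metis not_squarefree_0)
  have n: "n = d * (n div d)" using assms by simp
  show "squarefree d" "squarefree (n div d)"
    using assms(1) n by (metis squarefree_multD)+
  show "n div d > 1"
    using n n0 assms(3) by (metis One_nat_def Suc_lessI mult_0_right mult_1_right neq0_conv)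
  have nz: "d \<noteq> 0" "n div d \<noteq> 0" using n n0 by (metis mult_0 mult_0_right)+
  have "prime_factors n = prime_factors d \<union> prime_factors (n div d)"
    using nz n prime_factors_product by metis
  \<comment> \<open>A prime shared by \<open>d\<close> and its cofactor would have its square
    dividing \<open>n\<close>.\<close>
  moreover have "q \<notin> prime_factors (n div d)" if "q \<in> prime_factors d" for q
  proof
    assume "q \<in> prime_factors (n div d)"
    then have "q ^ 2 dvd n"
      using that n by (metis in_prime_factors_imp_dvd mult_dvd_mono power2_eq_square)
    then have "is_unit q" using assms(1) by (rule squarefreeD[rotated])
    then show False using that by (metis in_prime_factors_imp_prime not_prime_unit)
  qed
  ultimately show "prime_factors (n div d) = prime_factors n - prime_factors d" by blast
qed

lemma ex_M_set_prescribed_Legendre: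
  fixes n d :: nat
  assumes "squarefree n" "odd n" "d dvd n" "d \<noteq> n"
    and s: "\<And>p. s p = 1 \<or> s p = - 1"
  shows "\<exists>j\<in>M_set n d. \<forall>p\<in>prime_factors (n div d). Legendre (int j) (int p) = s p"
proof -
  note cof = proper_divisor_cofactor[OF assms(1,3,4)]
  have n0: "n \<noteq> 0" using assms(1) by (metis not_squarefree_0)
  \<comment> \<open>Symbol 0 at the primes of \<open>d\<close> forces them to divide
    \<open>j\<close>; a symbol 1 or -1 keeps all other primes of \<open>n\<close> out of
    \<open>j\<close>. So \<open>gcd j n\<close> has exactly the primes of \<open>d\<close>.\<close>
  define s' where "s' p = (if p dvd d then 0 else s p)" for p
  obtain j where j: "j < n" "\<And>p. p \<in> prime_factors n \<Longrightarrow> Legendre (int j) (int p) = s' p"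
    using ex_prescribed_Legendre[OF assms(1,2), of s'] s unfolding s'_def
    by (metis insertCI)
  have d0: "d \<noteq> 0" using assms(3) n0 by auto
  have dvd: "q dvd j \<longleftrightarrow> q dvd d" if "q \<in> prime_factors n" for q
  proof -
    have "q dvd j \<longleftrightarrow> Legendre (int j) (int q) = 0"
      by (simp add: Legendre_def cong_0_iff)
    also have "\<dots> \<longleftrightarrow> q dvd d" using j(2)[OF that] s[of q] by (auto simp: s'_def)
    finally show ?thesis .
  qed
  have "gcd j n = d"
  proof (rule squarefree_prime_factors_eqI)
    show "squarefree (gcd j n)" using assms(1) squarefree_mono by blast
    show "squarefree d" by (rule cof)
    have "gcd j n \<noteq> 0" using n0 by simp
    then show "prime_factors (gcd j n) = prime_factors d"
      using dvd n0 d0 assms(3) by (auto simp: prime_factors_dvd)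
  qed
  \<comment> \<open>The exponent 0 would have gcd \<open>n\<close> with \<open>n\<close>, and
    \<open>d\<close> is proper.\<close>
  moreover have "j \<noteq> 0" using calculation assms(4) by (metis gcd_0_left_nat)
  ultimately have "j \<in> M_set n d" using j(1) by (auto simp: M_set_def)
  moreover have "Legendre (int j) (int p) = s p" if "p \<in> prime_factors (n div d)" for p
    using j(2)[of p] that cof(4) d0 by (auto simp: s'_def prime_factors_dvd)
  ultimately show ?thesis by blast
qed

lemma M_star_squarefree:
  assumes "squarefree n" "d dvd n" "d \<noteq> n" "Q \<in> M_star n d"
  shows "squarefree Q" "prime_factors Q \<subseteq> prime_factors (n div d)" "prime_factors Q \<noteq> {}" "Q dvd n"
proof -
  note cof = proper_divisor_cofactor[OF assms(1-3)]
  have Q: "Q dvd n div d" "Q > 1" using assms(4) by (auto simp: M_star_def)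
  show "squarefree Q" using Q cof(2) squarefree_mono by blast
  show "prime_factors Q \<subseteq> prime_factors (n div d)"
    using Q(1) cof(3) by (intro dvd_prime_factors) auto
  show "prime_factors Q \<noteq> {}" using Q(2) by (auto simp: prime_factorization_empty_iff)
  show "Q dvd n" using Q(1) assms(2) by (metis dvd_div_mult_self dvd_mult2)
qed

text \<open>The whole sign is placed at one prime of \<open>Q\<close>, with symbol 1 at the others.
  Nonemptiness keeps conditions on single pieces from being vacuous.\<close>

lemma M_eps_nonempty:
  assumes "squarefree n" "odd n" "d dvd n" "d \<noteq> n" "Q \<in> M_star n d" "e \<in> {1,-1}"
  shows "M_eps n d Q e \<noteq> {}"
proof -
  note Q = M_star_squarefree[OF assms(1,3,4,5)]
  obtain a where a: "a \<in> prime_factors Q" using Q(3) by blast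
  obtain j where j: "j \<in> M_set n d"
    "\<forall>p\<in>prime_factors (n div d). Legendre (int j) (int p) = (if p = a then e else 1)"
    using ex_M_set_prescribed_Legendre[OF assms(1-4), of "\<lambda>p. if p = a then e else 1"] assms(6)
    by (metis insertE singletonD)
  have "Jacobi (int j) Q = (\<Prod>p\<in>prime_factors Q. if p = a then e else 1)"
    unfolding Jacobi_squarefree[OF Q(1)] using Q(2) j(2) by (intro prod.cong) auto
  also have "\<dots> = e" using a by (simp add: prod.delta)
  finally show ?thesis using j(1) by (auto simp: M_eps_def)
qed

lemma M_eps_subset_imp_prime_factors_subset:
  assumes "squarefree n" "odd n" "d dvd n" "d \<noteq> n" "Q \<in> M_star n d" "Q' \<in> M_star n d"
    and e: "e \<in> {1,-1}" "e' \<in> {1,-1}"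
    and sub: "M_eps n d Q' e' \<subseteq> M_eps n d Q e"
  shows "prime_factors Q \<subseteq> prime_factors Q'"
proof (rule ccontr)
  note Q = M_star_squarefree[OF assms(1,3,4,5)]
  note Q' = M_star_squarefree[OF assms(1,3,4,6)]
  assume "\<not> prime_factors Q \<subseteq> prime_factors Q'"
  then obtain a where a: "a \<in> prime_factors Q" "a \<notin> prime_factors Q'" by blast
  obtain b where b: "b \<in> prime_factors Q'" using Q'(3) by blast
  have "a \<noteq> b" using a b by auto
  \<comment> \<open>Adjusting the symbol at $b$ makes the one of $Q'$ equal to $e'$; the symbol at $a$ is then
    still free to make the one of $Q$ equal to $-e$.\<close>
  define c where "c = (if b \<in> prime_factors Q then - e * e' else - e)"
  define s where "s p = (if p = a then c else 1) * (if p = b then e' else 1)" for p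
  have "s p = 1 \<or> s p = - 1" for p using e by (auto simp: s_def c_def)
  then obtain j where j: "j \<in> M_set n d"
    "\<forall>p\<in>prime_factors (n div d). Legendre (int j) (int p) = s p"
    using ex_M_set_prescribed_Legendre[OF assms(1-4), of s] by auto
  have "Jacobi (int j) Q' = (\<Prod>p\<in>prime_factors Q'. s p)"
    unfolding Jacobi_squarefree[OF Q'(1)] using Q'(2) j(2) by (intro prod.cong) auto
  also have "\<dots> = e'" using a b unfolding s_def prod.distrib by (simp add: prod.delta)
  finally have "j \<in> M_eps n d Q' e'" using j(1) by (simp add: M_eps_def)
  then have "Jacobi (int j) Q = e" using sub by (auto simp: M_eps_def)
  moreover have "Jacobi (int j) Q = (\<Prod>p\<in>prime_factors Q. s p)"
    unfolding Jacobi_squarefree[OF Q(1)] using Q(2) j(2) by (intro prod.cong) auto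
  moreover have "\<dots> = c * (if b \<in> prime_factors Q then e' else 1)"
    using a unfolding s_def prod.distrib by (simp add: prod.delta)
  \<comment> \<open>If \<open>b\<close> divides \<open>Q\<close>, the factor \<open>e' * e'\<close>
    is 1; otherwise \<open>c\<close> alone is \<open>- e\<close>.\<close>
  moreover have "\<dots> = - e" using e by (auto simp: c_def)
  ultimately show False using e by auto
qed

text \<open>The two inclusions of prime sets determine the squarefree modulus; the sign is then read
  off any element of the common class.\<close>

lemma M_eps_eq_iff:
  assumes "squarefree n" "odd n" "d dvd n" "d \<noteq> n" "Q \<in> M_star n d" "Q' \<in> M_star n d"
    and e: "e \<in> {1,-1}" "e' \<in> {1,-1}"
  shows "M_eps n d Q e = M_eps n d Q' e' \<longleftrightarrow> Q = Q' \<and> e = e'"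
proof
  assume eq: "M_eps n d Q e = M_eps n d Q' e'"
  have "prime_factors Q = prime_factors Q'"
    using M_eps_subset_imp_prime_factors_subset[OF assms(1-4,5,6) e]
      M_eps_subset_imp_prime_factors_subset[OF assms(1-4,6,5) e(2,1)] eq by blast
  then have "Q = Q'"
    using M_star_squarefree(1)[OF assms(1,3,4)] assms(5,6) squarefree_prime_factors_eqI by blast
  moreover obtain j where "j \<in> M_eps n d Q e"
    using M_eps_nonempty[OF assms(1-5) e(1)] by blast
  ultimately show "Q = Q' \<and> e = e'" using eq by (auto simp: M_eps_def)
qed simp

lemma M_set_minus:
  assumes "j \<in> M_set n d"
  shows "n - j \<in> M_set n d"
proof -
  have j: "1 \<le> j" "j \<le> n - 1" "gcd j n = d" using assms by (auto simp: M_set_def)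
  have "gcd (n - j) n = gcd j n"
    using j by (metis diff_le_self gcd.commute gcd_diff1_nat gcd_diff2_nat le_trans)
  then show ?thesis using j by (auto simp: M_set_def)
qed

lemma Jacobi_minus_one:
  assumes "squarefree Q" "odd Q"
  shows "Jacobi (- 1) Q = (\<Prod>p\<in>prime_factors Q. if p mod 4 = 1 then 1 else - 1)"
  unfolding Jacobi_squarefree[OF assms(1)]
proof (intro prod.cong refl)
  fix p assume p: "p \<in> prime_factors Q"
  then have "prime p" "p \<noteq> 2" using assms(2) by auto
  then have "p > 2" using prime_ge_2_nat[of p] by simp
  then show "Legendre (- 1) (int p) = (if p mod 4 = 1 then 1 else - 1)"
    using Legendre_minus_one \<open>prime p\<close> by blast
qed

text \<open>The natural number \<open>n - j\<close> stands for the exponent -j; the two agree modulo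
  every prime of \<open>Q\<close> because \<open>Q\<close> divides \<open>n\<close>.\<close>

lemma Jacobi_minus:
  assumes "squarefree Q" "odd Q" "Q dvd n" "j \<le> n"
  shows "Jacobi (int (n - j)) Q = Jacobi (- 1) Q * Jacobi (int j) Q"
  unfolding Jacobi_squarefree[OF assms(1)] prod.distrib[symmetric]
proof (intro prod.cong refl)
  fix p assume p: "p \<in> prime_factors Q"
  then have "prime p" "p \<noteq> 2" using assms(2) by auto
  then have "p > 2" using prime_ge_2_nat[of p] by simp
  have "p dvd n" using p assms(3) by (meson dvd_trans in_prime_factors_imp_dvd)
  then have "[int (n - j) = - int j] (mod int p)"
    using assms(4) by (simp add: cong_iff_dvd_diff of_nat_diff)
  then show "Legendre (int (n - j)) (int p) = Legendre (- 1) (int p) * Legendre (int j) (int p)"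
    using Legendre_cong Legendre_minus[OF \<open>prime p\<close> \<open>p > 2\<close>] by metis
qed

subsection \<open>Cyclic codes and their zeros\<close>

text \<open>\<open>coeffs\<close> stops at the leading coefficient, whereas the right-hand side also
  sees the zeros beyond it; adding 0 to the list gives the full range of
  \<open>coeff\<close>.\<close>

lemma polys_over_iff:
  assumes "0 \<in> K"
  shows "f \<in> polys_over K \<longleftrightarrow> (\<forall>i. Polynomial.coeff f i \<in> K)"
proof -
  have "f \<in> polys_over K \<longleftrightarrow> insert 0 (set (Polynomial.coeffs f)) \<subseteq> K"
    using assms by (simp add: polys_over_def)
  then show ?thesis unfolding range_coeff[symmetric] by auto
qed

text \<open>Duality is treated for arbitrary sets of zeros among the roots of unity; a QR generator
  is brought into this form only afterwards.\<close>

definition poly_with_roots :: "'a::field set \<Rightarrow> 'a poly" where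
  "poly_with_roots Z = (\<Prod>z\<in>Z. [:- z, 1:])"

lemma poly_poly_with_roots_eq_0_iff:
  assumes "finite Z"
  shows "poly (poly_with_roots Z) x = 0 \<longleftrightarrow> x \<in> Z"
  using assms by (auto simp: poly_with_roots_def poly_prod)

lemma poly_with_roots_nonzero: "poly_with_roots Z \<noteq> 0"
  \<comment> \<open>For infinite \<open>Z\<close> the product is 1 by convention.\<close>
  by (cases "finite Z") (auto simp: poly_with_roots_def)

text \<open>A new zero is not a root of the product already split off, so it must be a root of the
  cofactor.\<close>

lemma poly_with_roots_dvd:
  assumes "finite Z" "\<And>z. z \<in> Z \<Longrightarrow> poly c z = 0"
  shows "poly_with_roots Z dvd c"
  using assms
proof (induction Z rule: finite_induct)
  case empty
  then show ?case by (simp add: poly_with_roots_def)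
next
  case (insert z Z)
  then obtain h where h: "c = poly_with_roots Z * h" by (auto elim: dvdE)
  have "poly c z = 0" using insert.prems by simp
  then have "poly h z = 0"
    using h insert.hyps poly_poly_with_roots_eq_0_iff[of Z z] by simp
  then have "[:- z, 1:] dvd h" by (simp add: poly_eq_0_iff_dvd)
  then have "[:- z, 1:] * poly_with_roots Z dvd c"
    unfolding h by (metis dvd_refl mult.commute mult_dvd_mono)
  then show ?case using insert.hyps by (simp add: poly_with_roots_def)
qed

text \<open>Of the finite field only this enters: \<open>n\<close> is invertible, a primitive
  \<open>n\<close>-th root of unity exists, and the \<open>q\<close>-th power map is
  additive.\<close>

locale cyclic_code_field =
  fixes n q :: nat and \<theta> :: "'a::field"
  assumes n_pos: "n > 0" and q_pos: "q > 0"
    and prim: "prim_root_unity n \<theta>"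
    and n_nonzero: "of_nat n \<noteq> (0::'a)"
    and frobenius_add: "\<And>x y::'a. (x + y) ^ q = x ^ q + y ^ q"
begin

section \<open>Fourier analysis on the n-th roots of unity\<close>

definition U :: "'a set" where
  "U = {x. x ^ n = 1}"

lemma theta_nonzero: "\<theta> \<noteq> 0"
  using prim n_pos by (auto simp: prim_root_unity_def power_0_left)

lemma theta_power_eq_iff:
  assumes "i < n" "j < n"
  shows "\<theta> ^ i = \<theta> ^ j \<longleftrightarrow> i = j"
proof -
  have *: "False" if "i < j" "j < n" "\<theta> ^ i = \<theta> ^ j" for i j
  proof -
    have "\<theta> ^ j = \<theta> ^ i * \<theta> ^ (j - i)" using that(1) by (metis less_imp_le_nat le_add_diff_inverse power_add)
    then have "\<theta> ^ (j - i) = 1" using that theta_nonzero by simp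
    then show False using prim that by (auto simp: prim_root_unity_def)
  qed
  then show ?thesis using assms by (metis linorder_neqE_nat)
qed

lemma inj_on_theta_power: "inj_on (\<lambda>j. \<theta> ^ j) {..<n}"
  using theta_power_eq_iff by (auto simp: inj_on_def)

lemma U_roots: "U = {x. poly (Polynomial.monom 1 n - 1) x = 0}"
  by (auto simp: U_def poly_monom)

lemma modulus_nonzero: "Polynomial.monom 1 n - 1 \<noteq> (0 :: 'a poly)"
  and degree_modulus: "Polynomial.degree (Polynomial.monom 1 n - 1 :: 'a poly) = n"
proof -
  show "Polynomial.degree (Polynomial.monom 1 n - 1 :: 'a poly) = n"
    using n_pos degree_add_eq_left[of "- 1 :: 'a poly" "Polynomial.monom 1 n"]
    by (simp add: degree_monom_eq)
  then show "Polynomial.monom 1 n - 1 \<noteq> (0 :: 'a poly)" using n_pos by auto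
qed

lemma finite_U: "finite U"
  unfolding U_roots by (rule poly_roots_finite[OF modulus_nonzero])

text \<open>The first \<open>n\<close> powers of \<open>\<theta>\<close> are distinct, and a
  polynomial of degree \<open>n\<close> has no further roots.\<close>

lemma U_eq: "U = (\<lambda>j. \<theta> ^ j) ` {..<n}"
proof (rule sym, rule card_seteq[OF finite_U])
  have "(\<theta> ^ j) ^ n = 1" for j
    using prim by (metis mult.commute power_mult power_one prim_root_unity_def)
  then show "(\<lambda>j. \<theta> ^ j) ` {..<n} \<subseteq> U" by (auto simp: U_def)
  have "card U \<le> n"
    using card_poly_roots_bound[OF modulus_nonzero] degree_modulus unfolding U_roots by simp
  then show "card U \<le> card ((\<lambda>j. \<theta> ^ j) ` {..<n})"
    using card_image[OF inj_on_theta_power] by simp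
qed

lemma theta_U: "\<theta> \<in> U"
  using prim by (simp add: U_def prim_root_unity_def)

lemma card_U: "card U = n"
  unfolding U_eq using card_image[OF inj_on_theta_power] by simp

lemma U_closed:
  "x \<in> U \<Longrightarrow> y \<in> U \<Longrightarrow> x * y \<in> U" "x \<in> U \<Longrightarrow> inverse x \<in> U" "x \<in> U \<Longrightarrow> x ^ k \<in> U"
  "x \<in> U \<Longrightarrow> x \<noteq> 0"
  using n_pos
  by (auto simp: U_def power_mult_distrib power_inverse power_0_left mult.commute simp flip: power_mult)
     (metis mult.commute power_mult power_one)

lemma sum_powers_U:
  assumes "x \<in> U"
  shows "(\<Sum>k<n. x ^ k) = (if x = 1 then of_nat n else 0)"
proof -
  have "(x - 1) * (\<Sum>k<n. x ^ k) = 0"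
    using assms by (simp add: U_def flip: power_diff_1_eq)
  then show ?thesis by auto
qed

lemma poly_eq_sum:
  fixes v :: "'a poly"
  assumes "Polynomial.degree v < n"
  shows "poly v x = (\<Sum>i<n. Polynomial.coeff v i * x ^ i)"
  using assms unfolding poly_altdef by (intro sum.mono_neutral_left) (auto intro: coeff_eq_0)

text \<open>Parseval's identity. The standard inner product is bilinear, so an inverse takes the
  place of complex conjugation.\<close>

lemma inner_product_fourier:
  assumes "Polynomial.degree v < n" "Polynomial.degree c < n"
  shows "of_nat n * (\<Sum>i<n. Polynomial.coeff v i * Polynomial.coeff c i) =
    (\<Sum>x\<in>U. poly v (inverse x) * poly c x)"
proof -
  have orth: "(\<Sum>x\<in>U. inverse x ^ i * x ^ l) = (if i = l then of_nat n else 0)"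
    if "i < n" "l < n" for i l
  proof -
    have "(\<Sum>x\<in>U. inverse x ^ i * x ^ l) = (\<Sum>j<n. inverse (\<theta> ^ j) ^ i * (\<theta> ^ j) ^ l)"
      unfolding U_eq by (simp add: sum.reindex[OF inj_on_theta_power])
    also have "\<dots> = (\<Sum>j<n. (inverse (\<theta> ^ i) * \<theta> ^ l) ^ j)"
      by (simp add: power_mult_distrib power_inverse mult.commute flip: power_mult)
    also have "\<dots> = (if inverse (\<theta> ^ i) * \<theta> ^ l = 1 then of_nat n else 0)"
      using theta_U by (intro sum_powers_U U_closed)
    also have "inverse (\<theta> ^ i) * \<theta> ^ l = 1 \<longleftrightarrow> i = l"
      using theta_power_eq_iff[OF that] theta_nonzero by (auto simp: field_simps)
    finally show ?thesis .
  qed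
  have "(\<Sum>x\<in>U. poly v (inverse x) * poly c x) =
    (\<Sum>x\<in>U. \<Sum>i<n. \<Sum>l<n. Polynomial.coeff v i * Polynomial.coeff c l * (inverse x ^ i * x ^ l))"
    unfolding poly_eq_sum[OF assms(1)] poly_eq_sum[OF assms(2)] sum_product
    by (simp add: mult_ac)
  also have "\<dots> = (\<Sum>i<n. \<Sum>x\<in>U. \<Sum>l<n. Polynomial.coeff v i * Polynomial.coeff c l * (inverse x ^ i * x ^ l))"
    by (rule sum.swap)
  also have "\<dots> = (\<Sum>i<n. \<Sum>l<n. \<Sum>x\<in>U. Polynomial.coeff v i * Polynomial.coeff c l * (inverse x ^ i * x ^ l))"
    by (intro sum.cong refl sum.swap)
  also have "\<dots> = (\<Sum>i<n. \<Sum>l<n. if i = l then Polynomial.coeff v i * Polynomial.coeff c l * of_nat n else 0)"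
    by (intro sum.cong refl) (auto simp: orth simp flip: sum_distrib_left)
  also have "\<dots> = of_nat n * (\<Sum>i<n. Polynomial.coeff v i * Polynomial.coeff c i)"
    by (simp add: sum.delta sum_distrib_left mult_ac)
  finally show ?thesis by simp
qed

lemma eq_0_if_vanishes_on_U:
  assumes "Polynomial.degree c < n" "\<And>x. x \<in> U \<Longrightarrow> poly c x = 0"
  shows "c = 0"
  by (rule poly_eqI_degree[of U]) (use assms n_pos card_U in auto)

lemma poly_mod_modulus:
  assumes "x \<in> U"
  shows "poly (a mod (Polynomial.monom 1 n - 1)) x = poly a x"
proof -
  have "poly a x = poly (a div (Polynomial.monom 1 n - 1) * (Polynomial.monom 1 n - 1)
      + a mod (Polynomial.monom 1 n - 1)) x"
    by (simp only: div_mult_mod_eq)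
  also have "\<dots> = poly (a mod (Polynomial.monom 1 n - 1)) x"
    using assms unfolding U_roots poly_add poly_mult by simp
  finally show ?thesis by simp
qed

lemma degree_mod_modulus: "Polynomial.degree (a mod (Polynomial.monom 1 n - 1) :: 'a poly) < n"
  using degree_mod_less'[OF modulus_nonzero, of a] degree_modulus n_pos
  by (cases "a mod (Polynomial.monom 1 n - 1) = 0") auto

section \<open>The two base fields and the Frobenius map\<close>

definition admissible :: "'a set \<Rightarrow> 'a poly \<Rightarrow> bool" where
  "admissible K f \<longleftrightarrow> K = UNIV \<or> K = Fq q \<and> f \<in> polys_over (Fq q)"

lemma admissible_0_1:
  assumes "admissible K f"
  shows "0 \<in> K" "1 \<in> K"
  using assms q_pos by (auto simp: admissible_def Fq_def power_0_left)

lemma frobenius_sum: "(\<Sum>i\<in>A. h i :: 'a) ^ q = (\<Sum>i\<in>A. h i ^ q)"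
  by (induction A rule: infinite_finite_induct) (use q_pos in \<open>auto simp: frobenius_add power_0_left\<close>)

lemma frobenius_inj:
  assumes "x ^ q = (y::'a) ^ q"
  shows "x = y"
proof -
  \<comment> \<open>Expanding the power of \<open>(x - y) + y\<close> avoids any power of -1 and so
    any case split on the characteristic.\<close>
  have "(x - y) ^ q + y ^ q = x ^ q" using frobenius_add[of "x - y" y] by simp
  then have "(x - y) ^ q = 0" using assms by simp
  then show ?thesis by simp
qed

lemma frobenius_poly:
  assumes "f \<in> polys_over (Fq q)"
  shows "poly f (x ^ q) = poly f (x::'a) ^ q"
proof -
  have "Polynomial.coeff f i ^ q = Polynomial.coeff f i" for i
    using assms q_pos polys_over_iff[of "Fq q" f] by (auto simp: Fq_def power_0_left)
  then show ?thesis
    by (simp add: poly_altdef frobenius_sum power_mult_distrib mult.commute flip: power_mult)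
qed

text \<open>The coefficientwise Frobenius map fixes $f$ and $f h$, so by cancellation it fixes $h$.\<close>

lemma quotient_in_polys_over_Fq:
  assumes "f * h \<in> polys_over (Fq q)" "f \<in> polys_over (Fq q)" "f \<noteq> (0::'a poly)"
  shows "h \<in> polys_over (Fq q)"
proof -
  let ?\<phi> = "map_poly (\<lambda>x::'a. x ^ q)"
  have Fq0: "(0::'a) \<in> Fq q" using q_pos by (auto simp: Fq_def power_0_left)
  have c\<phi>: "Polynomial.coeff (?\<phi> p) i = Polynomial.coeff p i ^ q" for p i
    using q_pos by (intro coeff_map_poly) (simp add: power_0_left)
  have fixed: "?\<phi> p = p \<longleftrightarrow> p \<in> polys_over (Fq q)" for p
    unfolding polys_over_iff[OF Fq0] by (auto simp: poly_eq_iff c\<phi> Fq_def)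
  have "?\<phi> (f * h) = ?\<phi> f * ?\<phi> h"
    by (simp add: poly_eq_iff c\<phi> coeff_mult frobenius_sum power_mult_distrib)
  then have "f * h = f * ?\<phi> h" using assms fixed by metis
  then show ?thesis using assms(3) fixed by (metis mult_left_cancel)
qed

section \<open>Codes with a given set of zeros, and their duals\<close>

context
  fixes Z :: "'a set" and K :: "'a set"
  assumes Z_U: "Z \<subseteq> U" and adm: "admissible K (poly_with_roots Z)"
begin

lemma finite_Z: "finite Z"
  using Z_U finite_U finite_subset by blast

lemma cyclic_code_vanishes:
  assumes "c \<in> cyclic_code K n (poly_with_roots Z)" "z \<in> Z"
  shows "poly c z = 0"
  using assms Z_U poly_mod_modulus poly_poly_with_roots_eq_0_iff[OF finite_Z]
  by (auto simp: cyclic_code_def)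

text \<open>Divisibility yields a cofactor over the whole field; over F_q it descends because the
  generator and the word do. The degree bound makes reduction modulo \<open>x^n - 1\<close>
  harmless.\<close>

lemma in_cyclic_codeI:
  assumes c: "c \<in> words K n" and van: "\<And>z. z \<in> Z \<Longrightarrow> poly c z = 0"
  shows "c \<in> cyclic_code K n (poly_with_roots Z)"
proof -
  obtain h where h: "c = poly_with_roots Z * h"
    using poly_with_roots_dvd[OF finite_Z van] by (auto elim: dvdE)
  have "h \<in> polys_over K"
  proof (cases "K = UNIV")
    case False
    then have "K = Fq q" "poly_with_roots Z \<in> polys_over (Fq q)"
      using adm by (auto simp: admissible_def)
    then show ?thesis
      using c h quotient_in_polys_over_Fq poly_with_roots_nonzero by (auto simp: words_def)
  qed (simp add: polys_over_def)
  moreover have "(h * poly_with_roots Z) mod (Polynomial.monom 1 n - 1) = c"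
    using c degree_modulus h by (subst mod_poly_less) (auto simp: words_def mult.commute)
  ultimately show ?thesis unfolding cyclic_code_def by blast
qed

lemma in_dual_code_iff:
  assumes v: "v \<in> words K n"
  shows "v \<in> dual_code K n (cyclic_code K n (poly_with_roots Z)) \<longleftrightarrow>
    (\<forall>x\<in>U - Z. poly v (inverse x) = 0)"
proof
  have dv: "Polynomial.degree v < n" using v by (simp add: words_def)
  let ?f = "poly_with_roots Z"
  {
    assume dual: "v \<in> dual_code K n (cyclic_code K n ?f)"
    \<comment> \<open>Testing \<open>v\<close> against the shifts of the generator is enough.
      Monomials have coefficients 0 and 1, so the shifts lie in the code over either base field.
      They give all moments of the function \<open>poly v (inverse x) * poly ?f x\<close> on
      \<open>U\<close>.\<close>
    have shift: "(\<Sum>x\<in>U. poly v (inverse x) * poly ?f x * x ^ k) = 0" for k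
    proof -
      let ?c = "(Polynomial.monom 1 k * ?f) mod (Polynomial.monom 1 n - 1)"
      have "Polynomial.monom 1 k \<in> polys_over K"
        using admissible_0_1[OF adm] by (simp add: polys_over_iff)
      then have "?c \<in> cyclic_code K n ?f" by (auto simp: cyclic_code_def)
      then have "(\<Sum>i<n. Polynomial.coeff v i * Polynomial.coeff ?c i) = 0"
        using dual by (auto simp: dual_code_def)
      then have "0 = (\<Sum>x\<in>U. poly v (inverse x) * poly ?c x)"
        using inner_product_fourier[OF dv degree_mod_modulus, of "Polynomial.monom 1 k * ?f"] by simp
      also have "\<dots> = (\<Sum>x\<in>U. poly v (inverse x) * poly ?f x * x ^ k)"
        by (intro sum.cong refl) (simp add: poly_mod_modulus poly_monom mult_ac)
      finally show ?thesis by simp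
    qed
    show "\<forall>x\<in>U - Z. poly v (inverse x) = 0"
    proof
      fix y assume y: "y \<in> U - Z"
      \<comment> \<open>Fourier inversion: weighting the moments by powers of
        \<open>inverse y\<close> isolates the value at \<open>y\<close>, where the generator does
        not vanish.\<close>
      have "0 = (\<Sum>k<n. (\<Sum>x\<in>U. poly v (inverse x) * poly ?f x * x ^ k) * inverse y ^ k)"
        by (simp add: shift)
      also have "\<dots> = (\<Sum>k<n. \<Sum>x\<in>U. poly v (inverse x) * poly ?f x * (x * inverse y) ^ k)"
        unfolding sum_distrib_right by (simp add: power_mult_distrib mult_ac)
      also have "\<dots> = (\<Sum>x\<in>U. poly v (inverse x) * poly ?f x * (\<Sum>k<n. (x * inverse y) ^ k))"
        by (subst sum.swap) (simp add: sum_distrib_left)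
      also have "\<dots> = (\<Sum>x\<in>U. if x = y then poly v (inverse x) * poly ?f x * of_nat n else 0)"
      proof (intro sum.cong refl)
        fix x assume x: "x \<in> U"
        have "x * inverse y \<in> U" using x y U_closed by blast
        moreover have "x * inverse y = 1 \<longleftrightarrow> x = y"
          using y U_closed(4) by (auto simp: field_simps)
        ultimately show "poly v (inverse x) * poly ?f x * (\<Sum>k<n. (x * inverse y) ^ k) =
          (if x = y then poly v (inverse x) * poly ?f x * of_nat n else 0)"
          by (simp add: sum_powers_U)
      qed
      also have "\<dots> = poly v (inverse y) * poly ?f y * of_nat n"
        using y finite_U by simp
      finally show "poly v (inverse y) = 0"
        using n_nonzero y poly_poly_with_roots_eq_0_iff[OF finite_Z, of y] by simp
    qed
  }
  {
    assume van: "\<forall>x\<in>U - Z. poly v (inverse x) = 0"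
    have "(\<Sum>i<n. Polynomial.coeff v i * Polynomial.coeff c i) = 0"
      if c: "c \<in> cyclic_code K n ?f" for c
    proof -
      have "Polynomial.degree c < n" using c degree_mod_modulus by (auto simp: cyclic_code_def)
      then have "of_nat n * (\<Sum>i<n. Polynomial.coeff v i * Polynomial.coeff c i) =
        (\<Sum>x\<in>U. poly v (inverse x) * poly c x)"
        by (rule inner_product_fourier[OF dv])
      \<comment> \<open>In every summand one factor vanishes: the codeword on \<open>Z\<close>, the
        other factor off \<open>Z\<close>.\<close>
      also have "\<dots> = 0" using van cyclic_code_vanishes[OF c] by (intro sum.neutral) auto
      finally show ?thesis using n_nonzero by simp
    qed
    then show "v \<in> dual_code K n (cyclic_code K n ?f)" using v by (simp add: dual_code_def)
  }
qed

text \<open>The word is, up to the factor $n$, the inverse Fourier transform of the indicator function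
  of \<open>P\<close>.\<close>

lemma ex_word_with_support:
  assumes P: "\<And>x. K = Fq q \<Longrightarrow> poly_with_roots Z \<in> polys_over (Fq q) \<Longrightarrow> x \<in> U \<Longrightarrow> P (x ^ q) \<longleftrightarrow> P x"
  shows "\<exists>w\<in>words K n. \<forall>x\<in>U. poly w x = 0 \<longleftrightarrow> \<not> P x"
proof -
  define J where "J = {x \<in> U. P x}"
  have fin: "finite J" using finite_U by (simp add: J_def)
  define a where "a i = (\<Sum>y\<in>J. inverse y ^ i)" for i
  define w where "w = (\<Sum>i<n. Polynomial.monom (a i) i)"
  have coeff_w: "Polynomial.coeff w i = (if i < n then a i else 0)" for i
    by (simp add: w_def coeff_sum)
  \<comment> \<open>If \<open>w\<close> is nonzero, its leading coefficient sits at an index below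
    \<open>n\<close>; otherwise the degree is 0.\<close>
  have "Polynomial.degree w < n"
    using n_pos by (metis coeff_w degree_0 leading_coeff_0_iff)
  moreover have "a i \<in> K" for i
  proof (cases "K = UNIV")
    case False
    then have K: "K = Fq q" "poly_with_roots Z \<in> polys_over (Fq q)"
      using adm by (auto simp: admissible_def)
    have inj: "inj_on (\<lambda>x. x ^ q) J" using frobenius_inj by (auto simp: inj_on_def)
    have "(\<lambda>x. x ^ q) ` J \<subseteq> J" using P[OF K] U_closed(3) by (auto simp: J_def)
    \<comment> \<open>Frobenius permutes the finite set \<open>J\<close>, so it only reorders the
      power sum \<open>a i\<close>, which is therefore fixed and lies in F_q.\<close>
    then have im: "(\<lambda>x. x ^ q) ` J = J" using endo_inj_surj fin inj by blast
    have "a i ^ q = (\<Sum>y\<in>J. inverse (y ^ q) ^ i)"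
      by (simp add: a_def frobenius_sum power_inverse mult.commute flip: power_mult)
    also have "\<dots> = (\<Sum>y\<in>(\<lambda>x. x ^ q) ` J. inverse y ^ i)"
      by (simp add: sum.reindex[OF inj])
    finally show ?thesis using im K by (simp add: a_def Fq_def)
  qed simp
  ultimately have "w \<in> words K n"
    using admissible_0_1[OF adm] by (auto simp: words_def polys_over_iff coeff_w)
  moreover have "poly w x = 0 \<longleftrightarrow> \<not> P x" if x: "x \<in> U" for x
  proof -
    have "poly w x = (\<Sum>i<n. \<Sum>y\<in>J. (x * inverse y) ^ i)"
      by (simp add: w_def poly_sum poly_monom a_def sum_distrib_left power_mult_distrib mult.commute[of _ "x ^ _"])
    also have "\<dots> = (\<Sum>y\<in>J. \<Sum>i<n. (x * inverse y) ^ i)" by (rule sum.swap)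
    also have "\<dots> = (\<Sum>y\<in>J. if y = x then of_nat n else 0)"
    proof (intro sum.cong refl)
      fix y assume "y \<in> J"
      then have y: "y \<in> U" by (simp add: J_def)
      have "x * inverse y \<in> U" using x y U_closed by blast
      moreover have "x * inverse y = 1 \<longleftrightarrow> y = x"
        using y U_closed(4) by (auto simp: field_simps)
      ultimately show "(\<Sum>i<n. (x * inverse y) ^ i) = (if y = x then of_nat n else 0)"
        by (simp add: sum_powers_U)
    qed
    also have "\<dots> = (if x \<in> J then of_nat n else 0)" using fin by simp
    finally show ?thesis using n_nonzero x by (simp add: J_def)
  qed
  ultimately show ?thesis by blast
qed

lemma frobenius_Z:
  assumes "poly_with_roots Z \<in> polys_over (Fq q)"
  shows "x ^ q \<in> Z \<longleftrightarrow> x \<in> Z"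
proof -
  have "poly (poly_with_roots Z) (x ^ q) = 0 \<longleftrightarrow> poly (poly_with_roots Z) x = 0"
    using frobenius_poly[OF assms] q_pos by simp
  then show ?thesis by (simp add: poly_poly_with_roots_eq_0_iff[OF finite_Z])
qed

lemma LCD_code_iff:
  "LCD_code K n (cyclic_code K n (poly_with_roots Z)) \<longleftrightarrow> (\<forall>z\<in>Z. inverse z \<in> Z)"
proof
  let ?C = "cyclic_code K n (poly_with_roots Z)"
  assume LCD: "LCD_code K n ?C"
  \<comment> \<open>The first conjunct puts the word into the code, the second into the dual. LCD
    makes the word 0, so no point of \<open>U\<close> satisfies both; this is applied at
    \<open>inverse z\<close>.\<close>
  let ?P = "\<lambda>x. x \<notin> Z \<and> inverse x \<in> Z"
  obtain w where w: "w \<in> words K n" "\<forall>x\<in>U. poly w x = 0 \<longleftrightarrow> \<not> ?P x"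
    using ex_word_with_support[of ?P] frobenius_Z by (auto simp flip: power_inverse)
  have "w \<in> ?C" using w Z_U by (intro in_cyclic_codeI) auto
  moreover have "w \<in> dual_code K n ?C"
    unfolding in_dual_code_iff[OF w(1)] using w(2) U_closed(2) by auto
  ultimately have "w = 0" using LCD by (auto simp: LCD_code_def)
  show "\<forall>z\<in>Z. inverse z \<in> Z"
  proof
    fix z assume z: "z \<in> Z"
    then have "inverse z \<in> U" using Z_U U_closed(2) by blast
    then show "inverse z \<in> Z" using w(2) \<open>w = 0\<close> z by auto
  qed
next
  let ?C = "cyclic_code K n (poly_with_roots Z)"
  assume sym: "\<forall>z\<in>Z. inverse z \<in> Z"
  have "0 \<in> words K n" using n_pos by (auto simp: words_def polys_over_def)
  then have "0 \<in> ?C \<inter> dual_code K n ?C"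
    using in_cyclic_codeI[of 0] in_dual_code_iff[of 0] by simp
  moreover have "c = 0" if c: "c \<in> ?C" "c \<in> dual_code K n ?C" for c
  proof (rule eq_0_if_vanishes_on_U)
    have cw: "c \<in> words K n" using c(2) by (simp add: dual_code_def)
    then show "Polynomial.degree c < n" by (simp add: words_def)
    fix x assume x: "x \<in> U"
    show "poly c x = 0"
    proof (cases "x \<in> Z")
      case True
      then show ?thesis using cyclic_code_vanishes[OF c(1)] by blast
    next
      case False
      \<comment> \<open>If \<open>inverse x\<close> were in \<open>Z\<close>, closure under
        inversion would put \<open>x\<close> there too.\<close>
      then have "inverse x \<in> U - Z" using x sym U_closed(2) by force
      then have "poly c (inverse (inverse x)) = 0" using c(2) in_dual_code_iff[OF cw] by blast
      then show ?thesis by simp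
    qed
  qed
  ultimately show "LCD_code K n ?C" by (auto simp: LCD_code_def)
qed

lemma self_orthogonal_iff:
  "self_orthogonal K n (cyclic_code K n (poly_with_roots Z)) \<longleftrightarrow> (\<forall>z\<in>Z. inverse z \<notin> Z)"
proof
  let ?C = "cyclic_code K n (poly_with_roots Z)"
  assume so: "self_orthogonal K n ?C"
  \<comment> \<open>The largest support that a dual word can have. Since this word lies in the code,
    it vanishes on \<open>Z\<close>, which makes \<open>Z\<close> and its set of inverses
    disjoint.\<close>
  let ?P = "\<lambda>x. inverse x \<in> Z"
  obtain w where w: "w \<in> words K n" "\<forall>x\<in>U. poly w x = 0 \<longleftrightarrow> \<not> ?P x"
    using ex_word_with_support[of ?P] frobenius_Z by (auto simp flip: power_inverse)
  have "w \<in> dual_code K n ?C"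
    unfolding in_dual_code_iff[OF w(1)] using w(2) U_closed(2) by auto
  then have "w \<in> ?C" using so by (auto simp: self_orthogonal_def)
  then show "\<forall>z\<in>Z. inverse z \<notin> Z" using cyclic_code_vanishes w(2) Z_U by blast
next
  let ?C = "cyclic_code K n (poly_with_roots Z)"
  assume asym: "\<forall>z\<in>Z. inverse z \<notin> Z"
  have "v \<in> ?C" if v: "v \<in> dual_code K n ?C" for v
  proof (rule in_cyclic_codeI)
    show vw: "v \<in> words K n" using v by (simp add: dual_code_def)
    fix z assume z: "z \<in> Z"
    then have "inverse z \<in> U - Z" using asym Z_U U_closed(2) by blast
    then have "poly v (inverse (inverse z)) = 0" using v in_dual_code_iff[OF vw] by blast
    then show "poly v z = 0" by simp
  qed
  then show "self_orthogonal K n ?C" by (auto simp: self_orthogonal_def)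
qed

text \<open>The reduced generator is itself a codeword and has the values of the generator on
  \<open>U\<close>, so it already cuts the common zeros down to \<open>Z\<close>.\<close>

lemma common_zeros_cyclic_code:
  "{x \<in> U. \<forall>c\<in>cyclic_code K n (poly_with_roots Z). poly c x = 0} = Z"
proof -
  let ?f = "poly_with_roots Z"
  have "1 \<in> polys_over K" using admissible_0_1[OF adm] by (auto simp: polys_over_def)
  then have "(1 * ?f) mod (Polynomial.monom 1 n - 1) \<in> cyclic_code K n ?f"
    unfolding cyclic_code_def by blast
  then have "x \<in> Z" if "x \<in> U" "\<forall>c\<in>cyclic_code K n ?f. poly c x = 0" for x
    using that poly_mod_modulus[OF that(1), of "1 * ?f"] poly_poly_with_roots_eq_0_iff[OF finite_Z, of x]
    by auto
  then show ?thesis using cyclic_code_vanishes Z_U by blast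
qed

end

end

subsection \<open>Counting divisors of squarefree numbers\<close>

lemma bij_betw_Prod_divisors:
  fixes m :: nat
  assumes "squarefree m"
  shows "bij_betw Prod (Pow (prime_factors m)) {Q. Q dvd m}"
proof -
  have m0: "m \<noteq> 0" using assms by (metis not_squarefree_0)
  have S: "squarefree (\<Prod>S)" "prime_factors (\<Prod>S) = S" if "S \<subseteq> prime_factors m" for S
    using that by (auto intro!: squarefree_prod_primes finite_subset[OF that])
  have "inj_on Prod (Pow (prime_factors m))"
    using S(2) by (metis PowD inj_onI)
  moreover have "Prod ` Pow (prime_factors m) = {Q. Q dvd m}"
  proof (intro equalityI subsetI)
    fix Q assume "Q \<in> Prod ` Pow (prime_factors m)"
    then obtain S where S': "S \<subseteq> prime_factors m" "Q = \<Prod>S" by auto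
    then have "\<Prod>S dvd \<Prod>(prime_factors m)" by (intro prod_dvd_prod_subset) auto
    then show "Q \<in> {Q. Q dvd m}" using S' squarefree_prod_prime_factors[OF assms] by simp
  next
    fix Q assume "Q \<in> {Q. Q dvd m}"
    then have Q: "Q dvd m" by simp
    then have "Q = \<Prod>(prime_factors Q)"
      using squarefree_mono[OF _ assms] squarefree_prod_prime_factors by metis
    moreover have "prime_factors Q \<subseteq> prime_factors m" using Q m0 by (intro dvd_prime_factors) auto
    ultimately show "Q \<in> Prod ` Pow (prime_factors m)" by blast
  qed
  ultimately show ?thesis by (simp add: bij_betw_def)
qed

lemma prime_factors_Prod_subset:
  fixes m :: nat
  assumes "S \<subseteq> prime_factors m"
  shows "prime_factors (\<Prod>S) = S"
  using assms by (intro squarefree_prod_primes(2)) (auto intro: finite_subset[OF assms])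

lemma card_divisors_squarefree:
  fixes m :: nat
  assumes "squarefree m"
  shows "card {Q. Q dvd m} = 2 ^ card (prime_factors m)"
  using bij_betw_same_card[OF bij_betw_Prod_divisors[OF assms]] by (simp add: card_Pow)

lemma Prod_image_subsets_of_card:
  fixes m :: nat
  assumes "squarefree m"
  shows "Prod ` {S. S \<subseteq> prime_factors m \<and> card S = r} = {d. d dvd m \<and> card (prime_factors d) = r}"
proof (intro equalityI subsetI)
  note surj = bij_betw_imp_surj_on[OF bij_betw_Prod_divisors[OF assms]]
  {
    fix d assume "d \<in> Prod ` {S. S \<subseteq> prime_factors m \<and> card S = r}"
    then obtain S where S: "S \<subseteq> prime_factors m" "card S = r" "d = \<Prod>S" by blast
    then have "d dvd m" using surj by blast
    then show "d \<in> {d. d dvd m \<and> card (prime_factors d) = r}"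
      using S prime_factors_Prod_subset[OF S(1)] by simp
  next
    fix d assume d: "d \<in> {d. d dvd m \<and> card (prime_factors d) = r}"
    then obtain S where S: "S \<subseteq> prime_factors m" "d = \<Prod>S" using surj by blast
    then show "d \<in> Prod ` {S. S \<subseteq> prime_factors m \<and> card S = r}"
      using d prime_factors_Prod_subset[OF S(1)] by auto
  }
qed

lemma card_divisors_squarefree_omega:
  fixes m :: nat
  assumes "squarefree m"
  shows "card {d. d dvd m \<and> card (prime_factors d) = r} = card (prime_factors m) choose r"
proof -
  have "inj_on Prod {S. S \<subseteq> prime_factors m \<and> card S = r}"
    using bij_betw_imp_inj_on[OF bij_betw_Prod_divisors[OF assms]]
    by (rule inj_on_subset) auto
  then show ?thesis
    unfolding Prod_image_subsets_of_card[OF assms, symmetric] by (simp add: card_image n_subsets)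
qed

text \<open>The subtracted 1 accounts for the excluded divisor 1.\<close>

lemma card_M_star:
  assumes "squarefree n" "d dvd n" "d \<noteq> n"
  shows "card (M_star n d) = 2 ^ (card (prime_factors n) - card (prime_factors d)) - 1"
proof -
  note cof = proper_divisor_cofactor[OF assms]
  have "n \<noteq> 0" using assms(1) by (metis not_squarefree_0)
  then have sub: "prime_factors d \<subseteq> prime_factors n" using assms(2) by (intro dvd_prime_factors) auto
  have "M_star n d = {Q. Q dvd n div d} - {1}"
    using cof(3) by (auto simp: M_star_def) (metis Suc_lessI dvd_0_left_iff neq0_conv not_less_zero)
  then have "card (M_star n d) = card {Q. Q dvd n div d} - 1"
    by (simp add: card_Diff_singleton)
  then show ?thesis
    using card_divisors_squarefree[OF cof(2)] cof(4) card_Diff_subset[OF _ sub] by simp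
qed

subsection \<open>QR codes\<close>

locale qr_setting = cyclic_code_field n q \<theta> for n q :: nat and \<theta> :: "'a::field" +
  fixes g :: nat and p :: "nat \<Rightarrow> nat" and \<kappa> :: "'a poly \<Rightarrow> 'a set"
  assumes primes: "\<And>i. i \<in> {1..g} \<Longrightarrow> prime (p i) \<and> odd (p i)"
    and inj_p: "inj_on p {1..g}"
    and n_def: "n = (\<Prod>i\<in>{1..g}. p i)"
    and rule: "base_field_rule q \<kappa>"
begin

lemma n_eq_Prod: "n = \<Prod>(p ` {1..g})"
  unfolding n_def using inj_p by (simp add: prod.reindex)

lemma squarefree_n: "squarefree n"
  and prime_factors_n: "prime_factors n = p ` {1..g}"
proof -
  have "prime r" if "r \<in> p ` {1..g}" for r using that primes by blast
  then show "squarefree n" "prime_factors n = p ` {1..g}"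
    unfolding n_eq_Prod by (intro squarefree_prod_primes; simp)+
qed

lemma card_prime_factors_n: "card (prime_factors n) = g"
  unfolding prime_factors_n using inj_p by (simp add: card_image)

lemma odd_n: "odd n"
  unfolding n_def using primes by (simp add: even_prod_iff)

text \<open>The injection \<open>p\<close> carries index sets to sets of primes, so the layers no
  longer depend on the numbering of the primes.\<close>

lemma A_set_eq: "A_set p g r = {d. d dvd n \<and> card (prime_factors d) = r}"
proof -
  have "A_set p g r = (\<lambda>S. \<Prod>i\<in>S. p i) ` {S. S \<subseteq> {1..g} \<and> card S = r}"
    by (auto simp: A_set_def)
  also have "\<dots> = (\<lambda>S. \<Prod>(p ` S)) ` {S. S \<subseteq> {1..g} \<and> card S = r}"
  proof (intro image_cong refl)
    fix S assume "S \<in> {S. S \<subseteq> {1..g} \<and> card S = r}"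
    then have "inj_on p S" using inj_p inj_on_subset by blast
    then show "(\<Prod>i\<in>S. p i) = \<Prod>(p ` S)" by (simp add: prod.reindex)
  qed
  also have "\<dots> = Prod ` {S. S \<subseteq> prime_factors n \<and> card S = r}"
  proof -
    have "{S. S \<subseteq> prime_factors n \<and> card S = r} = (`) p ` {S. S \<subseteq> {1..g} \<and> card S = r}"
      unfolding prime_factors_n
    proof (intro equalityI subsetI)
      fix S assume "S \<in> {S. S \<subseteq> p ` {1..g} \<and> card S = r}"
      then obtain T where T: "T \<subseteq> {1..g}" "S = p ` T" "card S = r" by (auto simp: subset_image_iff)
      moreover have "card S = card T" using T inj_p by (metis card_image inj_on_subset)
      ultimately show "S \<in> (`) p ` {S. S \<subseteq> {1..g} \<and> card S = r}" by auto
    next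
      fix S assume "S \<in> (`) p ` {S. S \<subseteq> {1..g} \<and> card S = r}"
      then obtain T where T: "T \<subseteq> {1..g}" "S = p ` T" "card T = r" by auto
      moreover have "card S = card T" using T inj_p by (metis card_image inj_on_subset)
      ultimately show "S \<in> {S. S \<subseteq> p ` {1..g} \<and> card S = r}" by auto
    qed
    then show ?thesis by (simp add: image_image)
  qed
  also have "\<dots> = {d. d dvd n \<and> card (prime_factors d) = r}"
    by (rule Prod_image_subsets_of_card[OF squarefree_n])
  finally show ?thesis .
qed

definition D :: "nat set" where
  "D = {d. d dvd n \<and> d \<noteq> n}"

lemma D_eq: "D = (\<Union>r<g. A_set p g r)"
proof -
  have "d \<noteq> n \<longleftrightarrow> card (prime_factors d) < g" if "d dvd n" for d
  proof
    assume "d \<noteq> n"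
    then have "prime_factors d \<noteq> prime_factors n"
      using squarefree_prime_factors_eqI squarefree_n squarefree_mono[OF that] by blast
    moreover have "prime_factors d \<subseteq> prime_factors n"
      using that n_pos by (intro dvd_prime_factors) auto
    ultimately have "card (prime_factors d) < card (prime_factors n)"
      by (intro psubset_card_mono) auto
    then show "card (prime_factors d) < g" by (simp add: card_prime_factors_n)
  qed (auto simp: card_prime_factors_n)
  then show ?thesis unfolding A_set_eq D_def by auto
qed

lemma finite_D: "finite D"
  unfolding D_def using n_pos by simp

lemma D_dvd: "d \<in> D \<Longrightarrow> d dvd n" "d \<in> D \<Longrightarrow> d \<noteq> n"
  by (simp_all add: D_def)

definition T :: "(nat \<Rightarrow> nat) \<Rightarrow> (nat \<Rightarrow> int) \<Rightarrow> nat set" where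
  "T Q \<epsilon> = (\<Union>d\<in>D. M_eps n d (Q d) (\<epsilon> d))"

lemma M_set_bounds: "t \<in> M_set n d \<Longrightarrow> 0 < t \<and> t < n"
  by (auto simp: M_set_def)

lemma finite_M_eps: "finite (M_eps n d Q e)"
  by (rule finite_subset[of _ "{..<n}"]) (auto simp: M_eps_def dest: M_set_bounds)

lemma M_set_unique: "t \<in> M_set n d \<Longrightarrow> t \<in> M_set n d' \<Longrightarrow> d = d'"
  by (auto simp: M_set_def)

lemma T_bounds: "t \<in> T Q \<epsilon> \<Longrightarrow> 0 < t \<and> t < n"
  by (auto simp: T_def M_eps_def dest: M_set_bounds)

text \<open>The gcd with \<open>n\<close> tells which piece an exponent can come from, so within one
  class only the choice at \<open>d\<close> is visible.\<close>

lemma T_Int_M_set: "d \<in> D \<Longrightarrow> t \<in> M_set n d \<Longrightarrow> t \<in> T Q \<epsilon> \<longleftrightarrow> t \<in> M_eps n d (Q d) (\<epsilon> d)"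
  by (auto simp: T_def M_eps_def dest: M_set_unique)

definition Z :: "(nat \<Rightarrow> nat) \<Rightarrow> (nat \<Rightarrow> int) \<Rightarrow> 'a set" where
  "Z Q \<epsilon> = (\<lambda>t. \<theta> ^ t) ` T Q \<epsilon>"

lemma Z_subset_U: "Z Q \<epsilon> \<subseteq> U"
  unfolding Z_def U_eq using T_bounds by blast

lemma theta_power_in_Z_iff:
  assumes "t < n"
  shows "\<theta> ^ t \<in> Z Q \<epsilon> \<longleftrightarrow> t \<in> T Q \<epsilon>"
  using assms T_bounds theta_power_eq_iff by (auto simp: Z_def)

text \<open>The number of prime factors separates the layers, the gcd with \<open>n\<close>
  separates the pieces, and powers of \<open>\<theta>\<close> below \<open>n\<close> are distinct.
  So the nested products merge into one without repeated roots.\<close>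

lemma QR_generator_eq: "QR_generator \<theta> p g n Q \<epsilon> = poly_with_roots (Z Q \<epsilon>)"
proof -
  have "QR_generator \<theta> p g n Q \<epsilon> = (\<Prod>d\<in>D. F_poly \<theta> n d (Q d) (\<epsilon> d))"
    unfolding QR_generator_def D_eq
    using n_pos by (intro prod.UNION_disjoint[symmetric]) (auto simp: A_set_eq)
  also have "\<dots> = (\<Prod>t\<in>T Q \<epsilon>. [:- (\<theta> ^ t), 1:])"
    unfolding F_poly_def T_def
    by (intro prod.UNION_disjoint[symmetric])
       (simp_all add: finite_D finite_M_eps, auto simp: M_eps_def dest: M_set_unique)
  also have "\<dots> = poly_with_roots (Z Q \<epsilon>)"
    unfolding poly_with_roots_def Z_def
    by (subst prod.reindex) (auto intro: inj_on_subset[OF inj_on_theta_power] dest: T_bounds)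
  finally show ?thesis .
qed

lemma admissible_rule: "admissible (\<kappa> f) f"
  using rule by (auto simp: base_field_rule_def admissible_def)

definition code :: "(nat \<Rightarrow> nat) \<Rightarrow> (nat \<Rightarrow> int) \<Rightarrow> 'a poly set" where
  "code Q \<epsilon> = cyclic_code (\<kappa> (poly_with_roots (Z Q \<epsilon>))) n (poly_with_roots (Z Q \<epsilon>))"

lemma QR_code_iff:
  "QR_code \<kappa> \<theta> p g n K C \<longleftrightarrow>
    (\<exists>Q \<epsilon>. (\<forall>d\<in>D. Q d \<in> M_star n d \<and> \<epsilon> d \<in> {1, -1}) \<and>
      K = \<kappa> (poly_with_roots (Z Q \<epsilon>)) \<and> C = code Q \<epsilon>)"
  unfolding QR_code_def QR_choice_def QR_generator_eq D_eq[symmetric] code_def by blast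

text \<open>The zeros are found by evaluating codewords, without reference to the base field. Hence
  codes taken over different base fields are told apart as well.\<close>

lemma code_eq_imp_choice_eq:
  assumes "code Q \<epsilon> = code Q' \<epsilon>'" "d \<in> D"
    and "Q d \<in> M_star n d" "Q' d \<in> M_star n d" "\<epsilon> d \<in> {1,-1}" "\<epsilon>' d \<in> {1,-1}"
  shows "Q d = Q' d \<and> \<epsilon> d = \<epsilon>' d"
proof -
  have "{x \<in> U. \<forall>c\<in>code Q \<epsilon>. poly c x = 0} = Z Q \<epsilon>" for Q \<epsilon>
    unfolding code_def by (rule common_zeros_cyclic_code[OF Z_subset_U admissible_rule])
  from this[of Q \<epsilon>] this[of Q' \<epsilon>'] have "Z Q \<epsilon> = Z Q' \<epsilon>'" by (simp add: assms(1))
  then have "t \<in> T Q \<epsilon> \<longleftrightarrow> t \<in> T Q' \<epsilon>'" if "t < n" for t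
    using theta_power_in_Z_iff[OF that, of Q \<epsilon>] theta_power_in_Z_iff[OF that, of Q' \<epsilon>'] by simp
  then have "t \<in> M_eps n d (Q d) (\<epsilon> d) \<longleftrightarrow> t \<in> M_eps n d (Q' d) (\<epsilon>' d)" if "t \<in> M_set n d" for t
    using T_Int_M_set[OF assms(2) that] M_set_bounds that by blast
  then have "M_eps n d (Q d) (\<epsilon> d) = M_eps n d (Q' d) (\<epsilon>' d)"
    by (auto simp: M_eps_def)
  then show ?thesis
    using M_eps_eq_iff[OF squarefree_n odd_n D_dvd[OF assms(2)] assms(3-)] by simp
qed

lemma card_QR_codes:
  "card {C. \<exists>K. QR_code \<kappa> \<theta> p g n K C} = (\<Prod>r<g. (2 * (2 ^ (g - r) - 1)) ^ (g choose r))"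
proof -
  \<comment> \<open>Extensional functions are counted: a choice is arbitrary outside
    \<open>D\<close>, and distinct choices that agree on \<open>D\<close> give the same
    code.\<close>
  define F where "F = (\<Pi>\<^sub>E d\<in>D. M_star n d \<times> {1, -1 :: int})"
  define h where "h \<phi> = code (\<lambda>d. fst (\<phi> d)) (\<lambda>d. snd (\<phi> d))" for \<phi> :: "nat \<Rightarrow> nat \<times> int"
  have "{C. \<exists>K. QR_code \<kappa> \<theta> p g n K C} = h ` F"
  proof (intro equalityI subsetI)
    fix C assume "C \<in> {C. \<exists>K. QR_code \<kappa> \<theta> p g n K C}"
    then obtain Q \<epsilon> where Q: "\<forall>d\<in>D. Q d \<in> M_star n d \<and> \<epsilon> d \<in> {1, -1}" "C = code Q \<epsilon>"
      unfolding QR_code_iff by blast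
    define \<phi> where "\<phi> = restrict (\<lambda>d. (Q d, \<epsilon> d)) D"
    have "\<phi> \<in> F" using Q(1) unfolding \<phi>_def F_def by auto
    \<comment> \<open>\<open>T\<close> reads its arguments on \<open>D\<close> only, so the
      restriction leaves the code unchanged.\<close>
    moreover have "Z (\<lambda>d. fst (\<phi> d)) (\<lambda>d. snd (\<phi> d)) = Z Q \<epsilon>"
      by (simp add: Z_def T_def \<phi>_def)
    then have "h \<phi> = C" by (simp add: h_def Q(2) code_def)
    ultimately show "C \<in> h ` F" by blast
  next
    fix C assume "C \<in> h ` F"
    then obtain \<phi> where \<phi>: "\<phi> \<in> F" "C = h \<phi>" by blast
    have "\<phi> d \<in> M_star n d \<times> {1, -1}" if "d \<in> D" for d using \<phi>(1) that unfolding F_def by (rule PiE_mem)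
    then have "\<forall>d\<in>D. fst (\<phi> d) \<in> M_star n d \<and> snd (\<phi> d) \<in> {1, -1}" by (auto simp: mem_Times_iff)
    then have "QR_code \<kappa> \<theta> p g n
        (\<kappa> (poly_with_roots (Z (\<lambda>d. fst (\<phi> d)) (\<lambda>d. snd (\<phi> d))))) C"
      unfolding QR_code_iff \<phi>(2) h_def
      by (intro exI[of _ "\<lambda>d. fst (\<phi> d)"] exI[of _ "\<lambda>d. snd (\<phi> d)"]) simp
    then show "C \<in> {C. \<exists>K. QR_code \<kappa> \<theta> p g n K C}" by blast
  qed
  moreover have "inj_on h F"
  proof (rule inj_onI)
    fix \<phi> \<psi> assume mem: "\<phi> \<in> F" "\<psi> \<in> F" and eq: "h \<phi> = h \<psi>"
    show "\<phi> = \<psi>"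
    proof (rule PiE_ext[OF mem[unfolded F_def]])
      fix d assume d: "d \<in> D"
      have "\<phi> d \<in> M_star n d \<times> {1, -1}" "\<psi> d \<in> M_star n d \<times> {1, -1}"
        using mem d unfolding F_def by (auto dest: PiE_mem)
      then show "\<phi> d = \<psi> d"
        using code_eq_imp_choice_eq[OF eq[unfolded h_def] d] by (auto simp: mem_Times_iff prod_eq_iff)
    qed
  qed
  ultimately have "card {C. \<exists>K. QR_code \<kappa> \<theta> p g n K C} = card F" by (simp add: card_image)
  also have "\<dots> = (\<Prod>d\<in>D. 2 * card (M_star n d))"
    unfolding F_def using finite_D by (simp add: card_PiE card_cartesian_product flip: mult_2)
  also have "\<dots> = (\<Prod>d\<in>D. 2 * (2 ^ (g - card (prime_factors d)) - 1))"
    by (intro prod.cong refl) (simp add: card_M_star[OF squarefree_n] D_dvd card_prime_factors_n)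
  also have "\<dots> = (\<Prod>r<g. \<Prod>d\<in>A_set p g r. 2 * (2 ^ (g - card (prime_factors d)) - 1))"
    unfolding D_eq using n_pos by (intro prod.UNION_disjoint) (auto simp: A_set_eq)
  also have "\<dots> = (\<Prod>r<g. \<Prod>d\<in>A_set p g r. 2 * (2 ^ (g - r) - 1))"
    by (intro prod.cong refl) (simp add: A_set_eq)
  also have "\<dots> = (\<Prod>r<g. (2 * (2 ^ (g - r) - 1)) ^ (g choose r))"
    using card_divisors_squarefree_omega[OF squarefree_n]
    by (simp add: A_set_eq card_prime_factors_n)
  finally show ?thesis .
qed

text \<open>Since \<open>n - t\<close> has the same gcd with \<open>n\<close> as \<open>t\<close>,
  only the choice at \<open>d\<close> matters, and the nonzero sign \<open>\<epsilon> d\<close>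
  cancels. The answer is thus the same for all \<open>t\<close> in one piece.\<close>

lemma inverse_in_Z_iff:
  assumes "t \<in> M_eps n d (Q d) (\<epsilon> d)" "d \<in> D" "Q d \<in> M_star n d" "\<epsilon> d \<in> {1,-1}"
  shows "inverse (\<theta> ^ t) \<in> Z Q \<epsilon> \<longleftrightarrow> Jacobi (- 1) (Q d) = 1"
proof -
  have t: "t \<in> M_set n d" "Jacobi (int t) (Q d) = \<epsilon> d" using assms(1) by (auto simp: M_eps_def)
  have b: "0 < t" "t < n" using M_set_bounds[OF t(1)] by auto
  note Qd = M_star_squarefree[OF squarefree_n D_dvd[OF assms(2)] assms(3)]
  have "odd (Q d)" using Qd(4) odd_n by (meson dvd_trans)
  have "\<theta> ^ t * \<theta> ^ (n - t) = 1"
    using b prim by (simp add: prim_root_unity_def flip: power_add)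
  then have "inverse (\<theta> ^ t) = \<theta> ^ (n - t)" by (rule inverse_unique)
  then have "inverse (\<theta> ^ t) \<in> Z Q \<epsilon> \<longleftrightarrow> n - t \<in> T Q \<epsilon>"
    using theta_power_in_Z_iff b by simp
  also have "\<dots> \<longleftrightarrow> Jacobi (int (n - t)) (Q d) = \<epsilon> d"
    using T_Int_M_set[OF assms(2) M_set_minus[OF t(1)]] M_set_minus[OF t(1)] by (simp add: M_eps_def)
  also have "\<dots> \<longleftrightarrow> Jacobi (- 1) (Q d) = 1"
    using Jacobi_minus[OF Qd(1) \<open>odd (Q d)\<close> Qd(4), of t] b t(2) assms(4) by auto
  finally show ?thesis .
qed

text \<open>Inversion keeps a whole piece inside \<open>Z\<close> or moves all of it out. As no
  piece is empty, quantifying over zeros amounts to quantifying over divisors.\<close>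

lemma
  assumes choice: "\<forall>d\<in>D. Q d \<in> M_star n d \<and> \<epsilon> d \<in> {1,-1}"
  shows Z_closed_iff: "(\<forall>z\<in>Z Q \<epsilon>. inverse z \<in> Z Q \<epsilon>) \<longleftrightarrow> (\<forall>d\<in>D. Jacobi (- 1) (Q d) = 1)"
    and Z_antisym_iff: "(\<forall>z\<in>Z Q \<epsilon>. inverse z \<notin> Z Q \<epsilon>) \<longleftrightarrow> (\<forall>d\<in>D. Jacobi (- 1) (Q d) \<noteq> 1)"
proof -
  have all: "(\<forall>z\<in>Z Q \<epsilon>. R z) \<longleftrightarrow> (\<forall>d\<in>D. \<forall>t\<in>M_eps n d (Q d) (\<epsilon> d). R (\<theta> ^ t))" for R
    by (auto simp: Z_def T_def)
  have ne: "M_eps n d (Q d) (\<epsilon> d) \<noteq> {}" if "d \<in> D" for d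
    using M_eps_nonempty[OF squarefree_n odd_n D_dvd[OF that]] choice that by blast
  have iff: "inverse (\<theta> ^ t) \<in> Z Q \<epsilon> \<longleftrightarrow> Jacobi (- 1) (Q d) = 1"
    if "d \<in> D" "t \<in> M_eps n d (Q d) (\<epsilon> d)" for d t
    using inverse_in_Z_iff[of t d Q \<epsilon>] choice that by blast
  show "(\<forall>z\<in>Z Q \<epsilon>. inverse z \<in> Z Q \<epsilon>) \<longleftrightarrow> (\<forall>d\<in>D. Jacobi (- 1) (Q d) = 1)"
    unfolding all using iff ne by blast
  show "(\<forall>z\<in>Z Q \<epsilon>. inverse z \<notin> Z Q \<epsilon>) \<longleftrightarrow> (\<forall>d\<in>D. Jacobi (- 1) (Q d) \<noteq> 1)"
    unfolding all using iff ne by blast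
qed

lemma ex_LCD_QR_code_iff:
  "(\<exists>K C. QR_code \<kappa> \<theta> p g n K C \<and> LCD_code K n C) \<longleftrightarrow>
    (\<exists>Q \<epsilon>. (\<forall>d\<in>D. Q d \<in> M_star n d \<and> \<epsilon> d \<in> {1, -1::int}) \<and> (\<forall>d\<in>D. Jacobi (- 1) (Q d) = 1))"
proof -
  have *: "LCD_code (\<kappa> (poly_with_roots (Z Q \<epsilon>))) n (code Q \<epsilon>) \<longleftrightarrow> (\<forall>d\<in>D. Jacobi (- 1) (Q d) = 1)"
    if "\<forall>d\<in>D. Q d \<in> M_star n d \<and> \<epsilon> d \<in> {1, -1}" for Q \<epsilon>
    using LCD_code_iff[OF Z_subset_U admissible_rule, of Q \<epsilon>] Z_closed_iff[OF that] by (simp add: code_def)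
  show ?thesis
  proof
    assume "\<exists>K C. QR_code \<kappa> \<theta> p g n K C \<and> LCD_code K n C"
    then obtain Q \<epsilon> where "\<forall>d\<in>D. Q d \<in> M_star n d \<and> \<epsilon> d \<in> {1, -1}"
      "LCD_code (\<kappa> (poly_with_roots (Z Q \<epsilon>))) n (code Q \<epsilon>)"
      unfolding QR_code_iff by blast
    then show "\<exists>Q \<epsilon>. (\<forall>d\<in>D. Q d \<in> M_star n d \<and> \<epsilon> d \<in> {1, -1::int}) \<and> (\<forall>d\<in>D. Jacobi (- 1) (Q d) = 1)"
      using * by blast
  next
    assume "\<exists>Q \<epsilon>. (\<forall>d\<in>D. Q d \<in> M_star n d \<and> \<epsilon> d \<in> {1, -1::int}) \<and> (\<forall>d\<in>D. Jacobi (- 1) (Q d) = 1)"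
    then obtain Q \<epsilon> where ch: "\<forall>d\<in>D. Q d \<in> M_star n d \<and> \<epsilon> d \<in> {1, -1::int}"
      and J: "\<forall>d\<in>D. Jacobi (- 1) (Q d) = 1" by (elim exE conjE)
    have "QR_code \<kappa> \<theta> p g n (\<kappa> (poly_with_roots (Z Q \<epsilon>))) (code Q \<epsilon>)"
      unfolding QR_code_iff using ch by blast
    moreover have "LCD_code (\<kappa> (poly_with_roots (Z Q \<epsilon>))) n (code Q \<epsilon>)"
      using *[OF ch] J by blast
    ultimately show "\<exists>K C. QR_code \<kappa> \<theta> p g n K C \<and> LCD_code K n C" by blast
  qed
qed

lemma ex_self_orthogonal_QR_code_iff:
  "(\<exists>K C. QR_code \<kappa> \<theta> p g n K C \<and> self_orthogonal K n C) \<longleftrightarrow>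
    (\<exists>Q \<epsilon>. (\<forall>d\<in>D. Q d \<in> M_star n d \<and> \<epsilon> d \<in> {1, -1::int}) \<and> (\<forall>d\<in>D. Jacobi (- 1) (Q d) \<noteq> 1))"
proof -
  have *: "self_orthogonal (\<kappa> (poly_with_roots (Z Q \<epsilon>))) n (code Q \<epsilon>) \<longleftrightarrow> (\<forall>d\<in>D. Jacobi (- 1) (Q d) \<noteq> 1)"
    if "\<forall>d\<in>D. Q d \<in> M_star n d \<and> \<epsilon> d \<in> {1, -1}" for Q \<epsilon>
    using self_orthogonal_iff[OF Z_subset_U admissible_rule, of Q \<epsilon>] Z_antisym_iff[OF that] by (simp add: code_def)
  show ?thesis
  proof
    assume "\<exists>K C. QR_code \<kappa> \<theta> p g n K C \<and> self_orthogonal K n C"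
    then obtain Q \<epsilon> where "\<forall>d\<in>D. Q d \<in> M_star n d \<and> \<epsilon> d \<in> {1, -1}"
      "self_orthogonal (\<kappa> (poly_with_roots (Z Q \<epsilon>))) n (code Q \<epsilon>)"
      unfolding QR_code_iff by blast
    then show "\<exists>Q \<epsilon>. (\<forall>d\<in>D. Q d \<in> M_star n d \<and> \<epsilon> d \<in> {1, -1::int}) \<and> (\<forall>d\<in>D. Jacobi (- 1) (Q d) \<noteq> 1)"
      using * by blast
  next
    assume "\<exists>Q \<epsilon>. (\<forall>d\<in>D. Q d \<in> M_star n d \<and> \<epsilon> d \<in> {1, -1::int}) \<and> (\<forall>d\<in>D. Jacobi (- 1) (Q d) \<noteq> 1)"
    then obtain Q \<epsilon> where ch: "\<forall>d\<in>D. Q d \<in> M_star n d \<and> \<epsilon> d \<in> {1, -1::int}"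
      and J: "\<forall>d\<in>D. Jacobi (- 1) (Q d) \<noteq> 1" by (elim exE conjE)
    have "QR_code \<kappa> \<theta> p g n (\<kappa> (poly_with_roots (Z Q \<epsilon>))) (code Q \<epsilon>)"
      unfolding QR_code_iff using ch by blast
    moreover have "self_orthogonal (\<kappa> (poly_with_roots (Z Q \<epsilon>))) n (code Q \<epsilon>)"
      using *[OF ch] J by blast
    ultimately show "\<exists>K C. QR_code \<kappa> \<theta> p g n K C \<and> self_orthogonal K n C" by blast
  qed
qed

section \<open>Reduction of the sign conditions to the single primes\<close>

lemma Jacobi_minus_one_prime:
  assumes "i \<in> {1..g}"
  shows "Jacobi (- 1) (p i) = (if p i mod 4 = 1 then 1 else - 1)"
  using primes[OF assms] by (simp add: Jacobi_minus_one squarefree_prime prime_factorization_prime)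

lemma M_star_maximal_divisor:
  assumes "i \<in> {1..g}"
  shows "n div p i \<in> D" "M_star n (n div p i) = {p i}"
proof -
  have pr: "prime (p i)" using primes[OF assms] by simp
  have dvd: "p i dvd n" unfolding n_def using assms by (intro dvd_prodI) auto
  then have eq: "n div (n div p i) = p i" using n_pos by (simp add: div_div_eq_right)
  have "n div p i < n" using n_pos prime_gt_1_nat[OF pr] by simp
  then show "n div p i \<in> D"
    using dvd by (simp add: D_def) (metis dvd_div_mult_self dvd_triv_left)
  show "M_star n (n div p i) = {p i}"
    unfolding M_star_def eq using pr prime_gt_1_nat[OF pr] by (auto simp: prime_nat_iff)
qed

lemma LCD_characterization:
  "(\<exists>K C. QR_code \<kappa> \<theta> p g n K C \<and> LCD_code K n C) \<longleftrightarrow> (\<forall>i\<in>{1..g}. p i mod 4 = 1)"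
  unfolding ex_LCD_QR_code_iff
proof
  assume "\<exists>Q \<epsilon>. (\<forall>d\<in>D. Q d \<in> M_star n d \<and> \<epsilon> d \<in> {1, -1::int}) \<and> (\<forall>d\<in>D. Jacobi (- 1) (Q d) = 1)"
  then obtain Q \<epsilon> where Q: "\<forall>d\<in>D. Q d \<in> M_star n d \<and> \<epsilon> d \<in> {1, -1::int}"
    "\<forall>d\<in>D. Jacobi (- 1) (Q d) = 1" by (elim exE conjE)
  show "\<forall>i\<in>{1..g}. p i mod 4 = 1"
  proof
    fix i assume i: "i \<in> {1..g}"
    have "Jacobi (- 1) (p i) = 1" using M_star_maximal_divisor[OF i] Q by force
    then show "p i mod 4 = 1" using Jacobi_minus_one_prime[OF i] by (metis one_neq_neg_one)
  qed
next
  assume p1: "\<forall>i\<in>{1..g}. p i mod 4 = 1"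
  \<comment> \<open>The largest modulus is a uniform witness: it exceeds 1 because \<open>d\<close>
    is proper, and all its primes contribute 1.\<close>
  have "n div d \<in> M_star n d \<and> Jacobi (- 1) (n div d) = 1" if "d \<in> D" for d
  proof -
    note cof = proper_divisor_cofactor[OF squarefree_n D_dvd[OF that]]
    have "n div d dvd n" using D_dvd(1)[OF that] by (metis dvd_div_mult_self dvd_triv_left)
    then have "odd (n div d)" using odd_n by (meson dvd_trans)
    then have "Jacobi (- 1) (n div d) = 1"
      using Jacobi_minus_one[OF cof(2)] cof(4) p1 prime_factors_n
      by (auto intro!: prod.neutral)
    then show ?thesis using cof(3) by (simp add: M_star_def)
  qed
  then show "\<exists>Q \<epsilon>. (\<forall>d\<in>D. Q d \<in> M_star n d \<and> \<epsilon> d \<in> {1, -1::int}) \<and> (\<forall>d\<in>D. Jacobi (- 1) (Q d) = 1)"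
    by (intro exI[of _ "\<lambda>d. n div d"] exI[of _ "\<lambda>_. 1"]) auto
qed

lemma self_orthogonal_characterization:
  "(\<exists>K C. QR_code \<kappa> \<theta> p g n K C \<and> self_orthogonal K n C) \<longleftrightarrow> (\<forall>i\<in>{1..g}. p i mod 4 \<noteq> 1)"
  unfolding ex_self_orthogonal_QR_code_iff
proof
  assume "\<exists>Q \<epsilon>. (\<forall>d\<in>D. Q d \<in> M_star n d \<and> \<epsilon> d \<in> {1, -1::int}) \<and> (\<forall>d\<in>D. Jacobi (- 1) (Q d) \<noteq> 1)"
  then obtain Q \<epsilon> where Q: "\<forall>d\<in>D. Q d \<in> M_star n d \<and> \<epsilon> d \<in> {1, -1::int}"
    "\<forall>d\<in>D. Jacobi (- 1) (Q d) \<noteq> 1" by (elim exE conjE)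
  show "\<forall>i\<in>{1..g}. p i mod 4 \<noteq> 1"
  proof
    fix i assume i: "i \<in> {1..g}"
    have "Jacobi (- 1) (p i) \<noteq> 1" using M_star_maximal_divisor[OF i] Q by force
    then show "p i mod 4 \<noteq> 1" using Jacobi_minus_one_prime[OF i] by auto
  qed
next
  assume p3: "\<forall>i\<in>{1..g}. p i mod 4 \<noteq> 1"
  \<comment> \<open>A single prime of \<open>n div d\<close> serves as modulus, so that exactly one
    factor -1 occurs.\<close>
  have "\<exists>Q. Q \<in> M_star n d \<and> Jacobi (- 1) Q \<noteq> 1" if "d \<in> D" for d
  proof -
    note cof = proper_divisor_cofactor[OF squarefree_n D_dvd[OF that]]
    obtain a where a: "prime a" "a dvd n div d" using cof(3) prime_factor_nat by (metis less_irrefl)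
    then have "a \<in> prime_factors (n div d)" using cof(3) by (simp add: prime_factors_dvd)
    then obtain i where i: "i \<in> {1..g}" "a = p i" using cof(4) prime_factors_n by auto
    then have "Jacobi (- 1) a \<noteq> 1" using Jacobi_minus_one_prime[OF i(1)] p3 by simp
    then show ?thesis using a prime_gt_1_nat[OF a(1)] by (auto simp: M_star_def)
  qed
  then obtain Q where "\<forall>d\<in>D. Q d \<in> M_star n d \<and> Jacobi (- 1) (Q d) \<noteq> 1" by metis
  then show "\<exists>Q \<epsilon>. (\<forall>d\<in>D. Q d \<in> M_star n d \<and> \<epsilon> d \<in> {1, -1::int}) \<and> (\<forall>d\<in>D. Jacobi (- 1) (Q d) \<noteq> 1)"
    by (intro exI[of _ Q] exI[of _ "\<lambda>_. 1"]) auto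
qed

end

text \<open>The characteristic divides the field size \<open>q ^ m\<close> and hence
  \<open>q\<close>; the only prime dividing a prime power is its base.\<close>

lemma primepow_CARD_eq_CHAR_power:
  assumes "primepow q" "CARD('a::{field,finite}) = q ^ m"
  shows "\<exists>k. q = CHAR('a) ^ k" "CHAR('a) dvd q" "prime CHAR('a)"
proof -
  show pr: "prime CHAR('a)"
    by (intro prime_CHAR_semidom finite_imp_CHAR_pos) simp
  have "CHAR('a) dvd q ^ m" using CHAR_dvd_CARD[where 'a='a] assms(2) by simp
  then show dvd: "CHAR('a) dvd q" using pr prime_dvd_power by blast
  obtain r k where r: "prime r" "q = r ^ k" using assms(1) by (auto simp: primepow_def)
  then have "CHAR('a) = r" using dvd pr by (metis prime_dvd_power primes_dvd_imp_eq)
  then show "\<exists>k. q = CHAR('a) ^ k" using r by blast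
qed

theorem theorem2p2:
  fixes g n q :: nat and p :: "nat \<Rightarrow> nat"
    and \<theta> :: "'a :: {field, finite}" and \<kappa> :: "'a poly \<Rightarrow> 'a set"
  assumes "g \<ge> 1"
    and "\<And>i. i \<in> {1..g} \<Longrightarrow> prime (p i) \<and> odd (p i)"
    and "inj_on p {1..g}"
    and "n = (\<Prod>i\<in>{1..g}. p i)"
    and "primepow q"
    and "gcd n q = 1"
    and "CARD('a) = q ^ ord n q"
    and "prim_root_unity n \<theta>"
    and "base_field_rule q \<kappa>"
  shows "card {C. \<exists>K. QR_code \<kappa> \<theta> p g n K C} =
           (\<Prod>r=0..g - 1. (2 * (2 ^ (g - r) - 1)) ^ (g choose r))
    \<and> ((\<exists>K C. QR_code \<kappa> \<theta> p g n K C \<and> LCD_code K n C)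
           \<longleftrightarrow> (\<forall>i\<in>{1..g}. [p i = 1] (mod 4)))
    \<and> ((\<exists>K C. QR_code \<kappa> \<theta> p g n K C \<and> self_orthogonal K n C)
           \<longleftrightarrow> (\<forall>i\<in>{1..g}. [p i = 3] (mod 4)))"
proof -
  note char = primepow_CARD_eq_CHAR_power[OF assms(5,7)]
  have n_pos: "n > 0" unfolding assms(4) using assms(2) by (intro prod_pos) (auto simp: prime_gt_0_nat)
  have q_pos: "q > 0" using assms(5) by (rule primepow_gt_0_nat)
  \<comment> \<open>The characteristic divides \<open>q\<close>, so it cannot divide
    \<open>n\<close>, which is coprime to \<open>q\<close>.\<close>
  have n_nonzero: "of_nat n \<noteq> (0::'a)"
  proof
    assume "of_nat n = (0::'a)"
    then have "CHAR('a) dvd gcd n q" using char(2) by (simp add: of_nat_eq_0_iff_char_dvd)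
    then show False using assms(6) char(3) by simp
  qed
  obtain k where "q = CHAR('a) ^ k" using char(1) by blast
  then have frob: "(x + y) ^ q = x ^ q + y ^ q" for x y :: 'a
    by (rule freshmans_dream'[OF char(3)])
  interpret qr_setting n q \<theta> g p \<kappa>
    by unfold_locales (fact n_pos q_pos assms n_nonzero frob)+
  \<comment> \<open>This is where \<open>g\<close> being positive matters: truncated subtraction
    would otherwise leave the index 0.\<close>
  have "{0..g - 1} = {..<g}" using assms(1) by auto
  \<comment> \<open>Odd primes leave only the residues 1 and 3, so failing to be 1 means being
    3.\<close>
  moreover have "p i mod 4 \<noteq> 1 \<longleftrightarrow> [p i = 3] (mod 4)" if "i \<in> {1..g}" for i
  proof -
    have "p i mod 4 = 1 \<or> p i mod 4 = 3"
      using assms(2)[OF that, THEN conjunct2] by presburger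
    then show ?thesis by (auto simp: cong_def)
  qed
  moreover have "p i mod 4 = 1 \<longleftrightarrow> [p i = 1] (mod 4)" for i
    by (simp add: cong_def)
  ultimately show ?thesis
    using card_QR_codes LCD_characterization self_orthogonal_characterization by simp
qed

end
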